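(* Let $(E\xrightarrow{\delta}G\to1,\{\,,\,\})$ be a braided crossed module with $G$ finite, let $x\in G$, and let $\Phi^x=(\psi^x,\phi^x)$ be the framed Reidemeister pair for $(\delta\colon E\to G,\triangleright')$ given by $$\phi^x(L,M)=\{Mx^{-1},Lx^{-1}\},\qquad\psi^x(L,M)=\{xML^{-1}x^{-1}Lx^{-1},Lx^{-1}\}^{-1}.$$ Let $K$ be an oriented knot, let $D$ be any diagram of $K$, presented as the closure of a string knot diagram, let $L_K$ be the associated (blackboard framed) string knot, and let $m,l\in\pi_1(C_K)$ be the meridian and longitude at the top end. Then, in $\mathbb{Z}[E]$, $$\sum_{a\in G}\langle1_G|I_{\Phi^x}(L_K)|a\rangle=\sum_{f\colon\pi_1(C_K)\to G,\ f(m)=x}\hat f(l_D),$$ where the right-hand sum is over group morphisms $f$, $\hat f\colon\pi_1(C_K)\otimes\pi_1(C_K)\to E$ is the group morphism with $\hat f(y\otimes z)=\{f(z),f(y)\}^{-1}$, and $l_D\in\pi_1(C_K)\otimes\pi_1(C_K)$ is the lift of the longitude $l$ determined by the diagram $D$ (defined in the context).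
   Context: $[a,b]=aba^{-1}b^{-1}$. A braided crossed module $(E\xrightarrow{\delta}G\to1,\{\,,\,\})$ is a 2-crossed module whose last group is trivial; explicitly: a group morphism $\delta\colon E\to G$ and a map $\{\,,\,\}\colon G\times G\to E$ such that for all $e,f,g\in G$, $k,l\in E$: $\delta(\{e,f\})=[e,f]$; $\{\delta(l),\delta(k)\}=[l,k]$; $\{\delta(l),e\}\{e,\delta(l)\}=1$; $\{ef,g\}=\{e,fgf^{-1}\}\{f,g\}$; $\{e,fg\}=\{e,f\}\,(f\triangleright'\{e,g\})$, where $e\triangleright' l:=l\{\delta(l)^{-1},e\}$. It is known that $(\delta\colon E\to G,\triangleright')$ is then a crossed module. Non-abelian tensor square: for a group $\pi$, $\pi\otimes\pi$ is generated by symbols $g\otimes h$ ($g,h\in\pi$) with relations $gh\otimes k=(ghg^{-1}\otimes gkg^{-1})(g\otimes k)$ and $g\otimes hk=(g\otimes h)(hgh^{-1}\otimes hkh^{-1})$. There is a morphism $\delta\colon\pi\otimes\pi\to\pi$, $g\otimes h\mapsto[g,h]$, and $(\pi\otimes\pi\xrightarrow{\delta}\pi\to1)$ is a braided crossed module with $\{n,m\}=(m\otimes n)^{-1}$ (and $g\triangleright'(h\otimes k)=ghg^{-1}\otimes gkg^{-1}$). $C_K$ is the complement of an open regular neighbourhood of $K$ in $S^3$. A string knot is a tangle whose underlying manifold is an interval, with one top and one bottom end point, oriented downwards; $L_K$ is a string knot with closure $K$, framed by the blackboard framing of the chosen diagram. Diagrams are sliced: horizontal strips, each containing vertical lines and at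 most one cup, cap, or crossing $X_+$ (positive) or $X_-$ (negative). In $X_+$ both strands point down, the over strand runs from top right to bottom left and the under strand from top left to bottom right. In $X_-$ both strands point down, the over strand runs from top left to bottom right and the under strand from top right to bottom left. Reidemeister colourings: for a crossed module $(\mu\colon P\to H,\cdot)$ and functions $\psi,\phi\colon H\times H\to P$, a colouring $F$ assigns elements of $H$ to arcs (extending prescribed labels at the end points) and elements of $P$ to crossings so that: at an $X_+$ with over arc $X$, bottom-right under arc $Y$, top-left under arc $Z$, the crossing carries $\psi(X,Y)$ and $Z=\mu(\psi(X,Y))^{-1}XYX^{-1}$; at an $X_-$ with over arc $X$, bottom-left under arc $Y$, top-right under arc $Z$, the crossing carries $\phi(X,Y)$ and $Z=X^{-1}\mu(\phi(X,Y))^{-1}YX$. The associated monoidal category has objects the elements of $H$, morphisms $U\xrightarrow{e}V$ with $e\in P$, $\mu(e)U=V$, composition $U\xrightarrow{e}V\xrightarrow{f}W=U\xrightarrow{fe}W$, tensor product $(U\xrightarrow{e}V)\otimes(U'\xrightarrow{e'}V')=(UU'\xrightarrow{(V\cdot e')e}VV')$. The evaluation $e(F)$ is obtained by tensoring horizontally and composing vertically (top to bottom), where $X_+$ gives $ZX\xrightarrow{\psi(X,Y)}XY$, $X_-$ gives $XZ\xrightarrow{\phi(X,Y)}YX$, vertical strands coloured $X$ give identities of $X$ (downwards) or $X^{-1}$ (upwards), cups and caps give morphisms with element $1_P$. For $H$ finite, $\langle a|I_\Phi(L_K)|b\rangle=\sum_Fe(F)$ over colourings with top label $a$ and bottom label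 $b$; a morphism $1_H\xrightarrow{e}a$ is regarded as the element $e\in P$, so $\langle1_G|I_{\Phi^x}(L_K)|a\rangle\in\mathbb{Z}[E]$. Meridian, longitude and $l_D$: let $\pi=\pi_1(C_K)$ with Wirtinger generators $g_a$ ($a$ the arcs of the string knot diagram) and relations $g_Zg_X=g_Xg_Y$ at each crossing $X_+$ with over arc $X$, bottom-right under arc $Y$ and top-left under arc $Z$, and $g_Xg_Z=g_Yg_X$ at each crossing $X_-$ with over arc $X$, bottom-left under arc $Y$ and top-right under arc $Z$. Let $a_1,\dots,a_n$ be the arcs in the order met from the top, $a_{j_i}$ the over arc and $\theta_i$ the sign of the crossing separating $a_i$ from $a_{i+1}$. Put $l_1=1$, $l_{i+1}=l_i\,g_{a_i}^{-\theta_i}g_{a_{j_i}}^{\theta_i}$ (partial longitudes); then $m=g_{a_1}$ and $l=l_n$ is the longitude. Colour the arc $a_i$ with $l_i\in\pi$, and colour the crossings with elements of $\pi\otimes\pi$ using the braided crossed module $(\pi\otimes\pi\to\pi\to1)$ and the functions $\phi^m(L,M)=\{Mm^{-1},Lm^{-1}\}$ and $\psi^m(L,M)=\{mML^{-1}m^{-1}Lm^{-1},Lm^{-1}\}^{-1}$ ($L,M\in\pi$): an $X_+$ whose over arc is coloured $L$ and whose bottom-right under arc is coloured $M$ carries $\psi^m(L,M)$, and an $X_-$ whose over arc is coloured $L$ and whose bottom-left under arc is coloured $M$ carries $\phi^m(L,M)$. This is a Reidemeister colouring $F$, and $l_D:=e(F)\in\pi\otimes\pi$, a morphism $1\to l$,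 so that $\delta(l_D)=l$. *)

theory Defs
  imports "HOL-Algebra.Coset" "HOL-Library.FuncSet" "HOL-Library.Poly_Mapping"
begin

section \<open>Groups given by generators and relations\<close>

text \<open>Words are lists of letters; the letter \<open>(s, True)\<close> stands for \<open>s\<close> and
  \<open>(s, False)\<close> for its inverse. A relation is a pair of words.\<close>

type_synonym 's word = "('s \<times> bool) list"

inductive pres_eq :: "'s set \<Rightarrow> ('s word \<times> 's word) set \<Rightarrow> 's word \<Rightarrow> 's word \<Rightarrow> bool"
  for S :: "'s set" and R :: "('s word \<times> 's word) set" where
  refl: "w \<in> lists (S \<times> UNIV) \<Longrightarrow> pres_eq S R w w"
| sym: "pres_eq S R u v \<Longrightarrow> pres_eq S R v u"
| trans: "pres_eq S R u v \<Longrightarrow> pres_eq S R v w \<Longrightarrow> pres_eq S R u w"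
| append: "pres_eq S R u u' \<Longrightarrow> pres_eq S R v v' \<Longrightarrow> pres_eq S R (u @ v) (u' @ v')"
| cancel: "s \<in> S \<Longrightarrow> pres_eq S R [(s, b), (s, \<not> b)] []"
| rel: "(u, v) \<in> R \<Longrightarrow> pres_eq S R u v"

definition pres_rel :: "'s set \<Rightarrow> ('s word \<times> 's word) set \<Rightarrow> ('s word \<times> 's word) set" where
  "pres_rel S R = {(u, v). pres_eq S R u v}"

definition presented_group :: "'s set \<Rightarrow> ('s word \<times> 's word) set \<Rightarrow> 's word set monoid" where
  "presented_group S R =
     \<lparr>carrier = lists (S \<times> UNIV) // pres_rel S R,
      monoid.mult = (\<lambda>A B. \<Union>u\<in>A. \<Union>v\<in>B. pres_rel S R `` {u @ v}),
      monoid.one = pres_rel S R `` {[]}\<rparr>"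

definition pres_gen :: "'s set \<Rightarrow> ('s word \<times> 's word) set \<Rightarrow> 's \<Rightarrow> 's word set" where
  "pres_gen S R s = pres_rel S R `` {[(s, True)]}"

text \<open>The group morphism out of a presented group with given values on the generators.\<close>

definition hom_on_gens ::
  "'s set \<Rightarrow> ('s word \<times> 's word) set \<Rightarrow> ('h, 'm) monoid_scheme \<Rightarrow> ('s \<Rightarrow> 'h) \<Rightarrow> 's word set \<Rightarrow> 'h" where
  "hom_on_gens S R H k =
     (THE h. h \<in> hom (presented_group S R) H \<inter> extensional (carrier (presented_group S R)) \<and>
             (\<forall>s\<in>S. h (pres_gen S R s) = k s))"

text \<open>\<open>G\<close> is presented by \<open>\<langle>S | R\<rangle>\<close>, with the generator \<open>s\<close> being the element \<open>g s\<close> of \<open>G\<close>.\<close>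

definition has_presentation ::
  "('h, 'm) monoid_scheme \<Rightarrow> ('s \<Rightarrow> 'h) \<Rightarrow> 's set \<Rightarrow> ('s word \<times> 's word) set \<Rightarrow> bool" where
  "has_presentation G g S R \<longleftrightarrow>
     group G \<and> (\<exists>\<theta> \<in> iso (presented_group S R) G. \<forall>s\<in>S. \<theta> (pres_gen S R s) = g s)"


section \<open>Braided crossed modules\<close>

definition commutator :: "('h, 'm) monoid_scheme \<Rightarrow> 'h \<Rightarrow> 'h \<Rightarrow> 'h" where
  "commutator G a b = a \<otimes>\<^bsub>G\<^esub> b \<otimes>\<^bsub>G\<^esub> inv\<^bsub>G\<^esub> a \<otimes>\<^bsub>G\<^esub> inv\<^bsub>G\<^esub> b"

text \<open>The derived action of \<open>G\<close> on \<open>E\<close>.\<close>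

definition braided_act ::
  "('e, 'k) monoid_scheme \<Rightarrow> ('h, 'm) monoid_scheme \<Rightarrow> ('e \<Rightarrow> 'h) \<Rightarrow> ('h \<Rightarrow> 'h \<Rightarrow> 'e) \<Rightarrow>
   'h \<Rightarrow> 'e \<Rightarrow> 'e" where
  "braided_act E G \<delta> br e l = l \<otimes>\<^bsub>E\<^esub> br (inv\<^bsub>G\<^esub> (\<delta> l)) e"

definition braided_crossed_module ::
  "('e, 'k) monoid_scheme \<Rightarrow> ('h, 'm) monoid_scheme \<Rightarrow> ('e \<Rightarrow> 'h) \<Rightarrow> ('h \<Rightarrow> 'h \<Rightarrow> 'e) \<Rightarrow> bool" where
  "braided_crossed_module E G \<delta> br \<longleftrightarrow>
     group E \<and> group G \<and> \<delta> \<in> hom E G \<and>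
     (\<forall>e\<in>carrier G. \<forall>f\<in>carrier G. br e f \<in> carrier E) \<and>
     (\<forall>e\<in>carrier G. \<forall>f\<in>carrier G. \<delta> (br e f) = commutator G e f) \<and>
     (\<forall>l\<in>carrier E. \<forall>k\<in>carrier E. br (\<delta> l) (\<delta> k) = commutator E l k) \<and>
     (\<forall>l\<in>carrier E. \<forall>e\<in>carrier G. br (\<delta> l) e \<otimes>\<^bsub>E\<^esub> br e (\<delta> l) = \<one>\<^bsub>E\<^esub>) \<and>
     (\<forall>e\<in>carrier G. \<forall>f\<in>carrier G. \<forall>g\<in>carrier G.
        br (e \<otimes>\<^bsub>G\<^esub> f) g = br e (f \<otimes>\<^bsub>G\<^esub> g \<otimes>\<^bsub>G\<^esub> inv\<^bsub>G\<^esub> f) \<otimes>\<^bsub>E\<^esub> br f g) \<and>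
     (\<forall>e\<in>carrier G. \<forall>f\<in>carrier G. \<forall>g\<in>carrier G.
        br e (f \<otimes>\<^bsub>G\<^esub> g) = br e f \<otimes>\<^bsub>E\<^esub> braided_act E G \<delta> br f (br e g))"

text \<open>The framed Reidemeister pair \<open>(\<psi>\<^sup>x, \<phi>\<^sup>x)\<close>.\<close>

definition phi_pair :: "('h, 'm) monoid_scheme \<Rightarrow> ('h \<Rightarrow> 'h \<Rightarrow> 'e) \<Rightarrow> 'h \<Rightarrow> 'h \<Rightarrow> 'h \<Rightarrow> 'e" where
  "phi_pair G br x L M = br (M \<otimes>\<^bsub>G\<^esub> inv\<^bsub>G\<^esub> x) (L \<otimes>\<^bsub>G\<^esub> inv\<^bsub>G\<^esub> x)"

definition psi_pair ::
  "('e, 'k) monoid_scheme \<Rightarrow> ('h, 'm) monoid_scheme \<Rightarrow> ('h \<Rightarrow> 'h \<Rightarrow> 'e) \<Rightarrow> 'h \<Rightarrow> 'h \<Rightarrow> 'h \<Rightarrow> 'e" where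
  "psi_pair E G br x L M =
     inv\<^bsub>E\<^esub> (br (x \<otimes>\<^bsub>G\<^esub> M \<otimes>\<^bsub>G\<^esub> inv\<^bsub>G\<^esub> L \<otimes>\<^bsub>G\<^esub> inv\<^bsub>G\<^esub> x \<otimes>\<^bsub>G\<^esub> L \<otimes>\<^bsub>G\<^esub> inv\<^bsub>G\<^esub> x)
               (L \<otimes>\<^bsub>G\<^esub> inv\<^bsub>G\<^esub> x))"


section \<open>The non-abelian tensor square\<close>

definition tensor_relations ::
  "('p, 'm) monoid_scheme \<Rightarrow> (('p \<times> 'p) word \<times> ('p \<times> 'p) word) set" where
  "tensor_relations \<pi> =
     {([((g \<otimes>\<^bsub>\<pi>\<^esub> h, k), True)],
       [((g \<otimes>\<^bsub>\<pi>\<^esub> h \<otimes>\<^bsub>\<pi>\<^esub> inv\<^bsub>\<pi>\<^esub> g, g \<otimes>\<^bsub>\<pi>\<^esub> k \<otimes>\<^bsub>\<pi>\<^esub> inv\<^bsub>\<pi>\<^esub> g), True), ((g, k), True)]) |g h k.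
        g \<in> carrier \<pi> \<and> h \<in> carrier \<pi> \<and> k \<in> carrier \<pi>} \<union>
     {([((g, h \<otimes>\<^bsub>\<pi>\<^esub> k), True)],
       [((g, h), True), ((h \<otimes>\<^bsub>\<pi>\<^esub> g \<otimes>\<^bsub>\<pi>\<^esub> inv\<^bsub>\<pi>\<^esub> h, h \<otimes>\<^bsub>\<pi>\<^esub> k \<otimes>\<^bsub>\<pi>\<^esub> inv\<^bsub>\<pi>\<^esub> h), True)]) |g h k.
        g \<in> carrier \<pi> \<and> h \<in> carrier \<pi> \<and> k \<in> carrier \<pi>}"

definition tensor_square :: "('p, 'm) monoid_scheme \<Rightarrow> ('p \<times> 'p) word set monoid" where
  "tensor_square \<pi> = presented_group (carrier \<pi> \<times> carrier \<pi>) (tensor_relations \<pi>)"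

definition tensor :: "('p, 'm) monoid_scheme \<Rightarrow> 'p \<Rightarrow> 'p \<Rightarrow> ('p \<times> 'p) word set" where
  "tensor \<pi> g h = pres_gen (carrier \<pi> \<times> carrier \<pi>) (tensor_relations \<pi>) (g, h)"

text \<open>The group morphism \<open>\<pi> \<otimes> \<pi> \<rightarrow> H\<close> with \<open>g \<otimes> h \<mapsto> k g h\<close>.\<close>

definition tensor_hom ::
  "('p, 'm) monoid_scheme \<Rightarrow> ('h, 'n) monoid_scheme \<Rightarrow> ('p \<Rightarrow> 'p \<Rightarrow> 'h) \<Rightarrow> ('p \<times> 'p) word set \<Rightarrow> 'h" where
  "tensor_hom \<pi> H k = hom_on_gens (carrier \<pi> \<times> carrier \<pi>) (tensor_relations \<pi>) H (\<lambda>(g, h). k g h)"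

definition tensor_delta :: "('p, 'm) monoid_scheme \<Rightarrow> ('p \<times> 'p) word set \<Rightarrow> 'p" where
  "tensor_delta \<pi> = tensor_hom \<pi> \<pi> (commutator \<pi>)"

definition tensor_braiding :: "('p, 'm) monoid_scheme \<Rightarrow> 'p \<Rightarrow> 'p \<Rightarrow> ('p \<times> 'p) word set" where
  "tensor_braiding \<pi> n m = inv\<^bsub>tensor_square \<pi>\<^esub> (tensor \<pi> m n)"

definition hat ::
  "('p, 'm) monoid_scheme \<Rightarrow> ('e, 'k) monoid_scheme \<Rightarrow> ('h \<Rightarrow> 'h \<Rightarrow> 'e) \<Rightarrow> ('p \<Rightarrow> 'h) \<Rightarrow>
   ('p \<times> 'p) word set \<Rightarrow> 'e" where
  "hat \<pi> E br f = tensor_hom \<pi> E (\<lambda>y z. inv\<^bsub>E\<^esub> (br (f z) (f y)))"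


section \<open>Sliced string knot diagrams\<close>

text \<open>A diagram is a list of strips, read from top to bottom. A strip consists of vertical lines
  (given by their orientations), a piece, and further vertical lines. A cap has its two end points
  at the bottom and a cup has them at the top; the parameter of a cap or cup is the orientation at
  its left end point.\<close>

datatype orient = Down | Up

fun opposite :: "orient \<Rightarrow> orient" where
  "opposite Down = Up"
| "opposite Up = Down"

datatype piece = Lines | Cap orient | Cup orient | XPos | XNeg

type_synonym strip = "orient list \<times> piece \<times> orient list"

type_synonym diagram = "strip list"

fun piece_top :: "piece \<Rightarrow> orient list" where
  "piece_top Lines = []"
| "piece_top (Cap d) = []"
| "piece_top (Cup d) = [d, opposite d]"
| "piece_top XPos = [Down, Down]"
| "piece_top XNeg = [Down, Down]"

fun piece_bot :: "piece \<Rightarrow> orient list" where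
  "piece_bot Lines = []"
| "piece_bot (Cap d) = [d, opposite d]"
| "piece_bot (Cup d) = []"
| "piece_bot XPos = [Down, Down]"
| "piece_bot XNeg = [Down, Down]"

fun strip_top :: "strip \<Rightarrow> orient list" where
  "strip_top (l, p, r) = l @ piece_top p @ r"

fun strip_bot :: "strip \<Rightarrow> orient list" where
  "strip_bot (l, p, r) = l @ piece_bot p @ r"

definition piece_at :: "diagram \<Rightarrow> nat \<Rightarrow> piece" where
  "piece_at D i = fst (snd (D ! i))"

definition left_at :: "diagram \<Rightarrow> nat \<Rightarrow> orient list" where
  "left_at D i = fst (D ! i)"

definition right_at :: "diagram \<Rightarrow> nat \<Rightarrow> orient list" where
  "right_at D i = snd (snd (D ! i))"

text \<open>Level \<open>i\<close> is the horizontal line above strip \<open>i\<close> (and below strip \<open>i - 1\<close>); the diagrams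
  considered have a single downward end point at the top, level \<open>0\<close>. The point \<open>(i, j)\<close> is the
  \<open>j\<close>-th intersection point of the diagram with level \<open>i\<close>, from left to right.\<close>

fun level :: "diagram \<Rightarrow> nat \<Rightarrow> orient list" where
  "level D 0 = [Down]"
| "level D (Suc i) = strip_bot (D ! i)"

type_synonym point = "nat \<times> nat"

definition points :: "diagram \<Rightarrow> point set" where
  "points D = {(i, j). i \<le> length D \<and> j < length (level D i)}"

text \<open>Pairs of points joined inside strip \<open>i\<close> by a strand that does not pass under another one.\<close>

definition joins_at :: "diagram \<Rightarrow> nat \<Rightarrow> (point \<times> point) set" where
  "joins_at D i =
     (let k = length (left_at D i); p = piece_at D i;
          a = k + length (piece_top p); b = k + length (piece_bot p)
      in {((i, j), (Suc i, j)) |j. j < k} \<union>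
         {((i, a + j), (Suc i, b + j)) |j. j < length (right_at D i)} \<union>
         (case p of
            Lines \<Rightarrow> {}
          | Cap d \<Rightarrow> {((Suc i, k), (Suc i, Suc k))}
          | Cup d \<Rightarrow> {((i, k), (i, Suc k))}
          | XPos \<Rightarrow> {((i, Suc k), (Suc i, k))}
          | XNeg \<Rightarrow> {((i, k), (Suc i, Suc k))}))"

text \<open>The pair of points joined by the under strand of strip \<open>i\<close>, if there is a crossing.\<close>

definition under_joins_at :: "diagram \<Rightarrow> nat \<Rightarrow> (point \<times> point) set" where
  "under_joins_at D i =
     (let k = length (left_at D i) in
      case piece_at D i of
        XPos \<Rightarrow> {((i, k), (Suc i, Suc k))}
      | XNeg \<Rightarrow> {((i, Suc k), (Suc i, k))}
      | _ \<Rightarrow> {})"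

definition joins :: "diagram \<Rightarrow> (point \<times> point) set" where
  "joins D = (\<Union>i<length D. joins_at D i)"

definition under_joins :: "diagram \<Rightarrow> (point \<times> point) set" where
  "under_joins D = (\<Union>i<length D. under_joins_at D i)"

text \<open>The last condition says that the underlying 1-manifold is connected, hence an interval.\<close>

definition string_knot_diagram :: "diagram \<Rightarrow> bool" where
  "string_knot_diagram D \<longleftrightarrow>
     (\<forall>i<length D. strip_top (D ! i) = level D i) \<and>
     level D (length D) = [Down] \<and>
     (\<forall>p\<in>points D. \<forall>q\<in>points D.
        (p, q) \<in> (joins D \<union> under_joins D \<union> (joins D \<union> under_joins D)\<inverse>)\<^sup>*)"

type_synonym arc = "point set"

definition arc_of :: "diagram \<Rightarrow> point \<Rightarrow> arc" where
  "arc_of D p = (joins D \<union> (joins D)\<inverse>)\<^sup>* `` {p}"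

definition arcs :: "diagram \<Rightarrow> arc set" where
  "arcs D = arc_of D ` points D"

definition top_arc :: "diagram \<Rightarrow> arc" where
  "top_arc D = arc_of D (0, 0)"

definition bottom_arc :: "diagram \<Rightarrow> arc" where
  "bottom_arc D = arc_of D (length D, 0)"

text \<open>A crossing is identified with the index of the strip containing it.\<close>

definition crossings :: "diagram \<Rightarrow> nat set" where
  "crossings D = {i. i < length D \<and> piece_at D i \<in> {XPos, XNeg}}"

definition over_arc :: "diagram \<Rightarrow> nat \<Rightarrow> arc" where
  "over_arc D i =
     (let k = length (left_at D i) in arc_of D (i, if piece_at D i = XPos then Suc k else k))"

text \<open>The under arc at the top (\<open>Z\<close>) and the under arc at the bottom (\<open>Y\<close>) of a crossing. Both
  strands point down, so \<open>Z\<close> is met first when following the orientation.\<close>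

definition under_top :: "diagram \<Rightarrow> nat \<Rightarrow> arc" where
  "under_top D i =
     (let k = length (left_at D i) in arc_of D (i, if piece_at D i = XPos then k else Suc k))"

definition under_bot :: "diagram \<Rightarrow> nat \<Rightarrow> arc" where
  "under_bot D i =
     (let k = length (left_at D i) in arc_of D (Suc i, if piece_at D i = XPos then Suc k else k))"

definition crossing_sign :: "diagram \<Rightarrow> nat \<Rightarrow> int" where
  "crossing_sign D i = (if piece_at D i = XPos then 1 else - 1)"


section \<open>Reidemeister colourings and the invariant\<close>

text \<open>A colouring is a pair of a function on arcs and a function on crossings.\<close>

type_synonym ('h, 'e) colouring = "(arc \<Rightarrow> 'h) \<times> (nat \<Rightarrow> 'e)"

definition reidemeister_colourings ::
  "('e, 'k) monoid_scheme \<Rightarrow> ('h, 'm) monoid_scheme \<Rightarrow> ('e \<Rightarrow> 'h) \<Rightarrow>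
   ('h \<Rightarrow> 'h \<Rightarrow> 'e) \<Rightarrow> ('h \<Rightarrow> 'h \<Rightarrow> 'e) \<Rightarrow> diagram \<Rightarrow> 'h \<Rightarrow> 'h \<Rightarrow> ('h, 'e) colouring set" where
  "reidemeister_colourings P H \<mu> \<psi> \<phi> D a b =
     {(c, t). c \<in> arcs D \<rightarrow>\<^sub>E carrier H \<and> t \<in> crossings D \<rightarrow>\<^sub>E carrier P \<and>
        c (top_arc D) = a \<and> c (bottom_arc D) = b \<and>
        (\<forall>i\<in>crossings D.
          (let X = c (over_arc D i); Y = c (under_bot D i); Z = c (under_top D i) in
           if piece_at D i = XPos
           then t i = \<psi> X Y \<and> Z = inv\<^bsub>H\<^esub> (\<mu> (\<psi> X Y)) \<otimes>\<^bsub>H\<^esub> X \<otimes>\<^bsub>H\<^esub> Y \<otimes>\<^bsub>H\<^esub> inv\<^bsub>H\<^esub> X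
           else t i = \<phi> X Y \<and> Z = inv\<^bsub>H\<^esub> X \<otimes>\<^bsub>H\<^esub> inv\<^bsub>H\<^esub> (\<mu> (\<phi> X Y)) \<otimes>\<^bsub>H\<^esub> Y \<otimes>\<^bsub>H\<^esub> X))}"

text \<open>A morphism \<open>U \<rightarrow> V\<close> with element \<open>e\<close> is the triple \<open>(U, e, V)\<close>.\<close>

type_synonym ('h, 'e) mor = "'h \<times> 'e \<times> 'h"

definition mor_id :: "('e, 'k) monoid_scheme \<Rightarrow> 'h \<Rightarrow> ('h, 'e) mor" where
  "mor_id P U = (U, \<one>\<^bsub>P\<^esub>, U)"

text \<open>\<open>mor_comp P F G\<close> is \<open>F\<close> followed by \<open>G\<close>.\<close>

fun mor_comp :: "('e, 'k) monoid_scheme \<Rightarrow> ('h, 'e) mor \<Rightarrow> ('h, 'e) mor \<Rightarrow> ('h, 'e) mor" where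
  "mor_comp P (U, e, V) (V', f, W) = (U, f \<otimes>\<^bsub>P\<^esub> e, W)"

fun mor_tensor ::
  "('e, 'k) monoid_scheme \<Rightarrow> ('h, 'm) monoid_scheme \<Rightarrow> ('h \<Rightarrow> 'e \<Rightarrow> 'e) \<Rightarrow>
   ('h, 'e) mor \<Rightarrow> ('h, 'e) mor \<Rightarrow> ('h, 'e) mor" where
  "mor_tensor P H act (U, e, V) (U', e', V') =
     (U \<otimes>\<^bsub>H\<^esub> U', act V e' \<otimes>\<^bsub>P\<^esub> e, V \<otimes>\<^bsub>H\<^esub> V')"

definition strand_obj :: "('h, 'm) monoid_scheme \<Rightarrow> orient \<Rightarrow> 'h \<Rightarrow> 'h" where
  "strand_obj H d X = (if d = Down then X else inv\<^bsub>H\<^esub> X)"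

text \<open>The object at the point \<open>q\<close> of orientation \<open>d\<close>.\<close>

definition point_obj ::
  "('h, 'm) monoid_scheme \<Rightarrow> diagram \<Rightarrow> (arc \<Rightarrow> 'h) \<Rightarrow> point \<Rightarrow> orient \<Rightarrow> 'h" where
  "point_obj H D c q d = strand_obj H d (c (arc_of D q))"

definition piece_mors ::
  "('e, 'k) monoid_scheme \<Rightarrow> ('h, 'm) monoid_scheme \<Rightarrow> diagram \<Rightarrow> ('h, 'e) colouring \<Rightarrow> nat \<Rightarrow>
   ('h, 'e) mor list" where
  "piece_mors P H D F i =
     (let (c, t) = F; k = length (left_at D i);
          X = c (over_arc D i); Y = c (under_bot D i); Z = c (under_top D i) in
      case piece_at D i of
        Lines \<Rightarrow> []
      | Cap d \<Rightarrow> [(\<one>\<^bsub>H\<^esub>, \<one>\<^bsub>P\<^esub>,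
                   point_obj H D c (Suc i, k) d \<otimes>\<^bsub>H\<^esub> point_obj H D c (Suc i, Suc k) (opposite d))]
      | Cup d \<Rightarrow> [(point_obj H D c (i, k) d \<otimes>\<^bsub>H\<^esub> point_obj H D c (i, Suc k) (opposite d),
                   \<one>\<^bsub>P\<^esub>, \<one>\<^bsub>H\<^esub>)]
      | XPos \<Rightarrow> [(Z \<otimes>\<^bsub>H\<^esub> X, t i, X \<otimes>\<^bsub>H\<^esub> Y)]
      | XNeg \<Rightarrow> [(X \<otimes>\<^bsub>H\<^esub> Z, t i, Y \<otimes>\<^bsub>H\<^esub> X)])"

text \<open>The identities of the vertical lines of strip \<open>i\<close> with orientations \<open>ds\<close>, the first of which
  starts at the point \<open>(i, s)\<close>.\<close>

definition line_mors ::
  "('e, 'k) monoid_scheme \<Rightarrow> ('h, 'm) monoid_scheme \<Rightarrow> diagram \<Rightarrow> ('h, 'e) colouring \<Rightarrow> nat \<Rightarrow> nat \<Rightarrow>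
   orient list \<Rightarrow> ('h, 'e) mor list" where
  "line_mors P H D F i s ds =
     map (\<lambda>j. mor_id P (point_obj H D (fst F) (i, s + j) (ds ! j))) [0..<length ds]"

definition strip_mor ::
  "('e, 'k) monoid_scheme \<Rightarrow> ('h, 'm) monoid_scheme \<Rightarrow> ('h \<Rightarrow> 'e \<Rightarrow> 'e) \<Rightarrow> diagram \<Rightarrow>
   ('h, 'e) colouring \<Rightarrow> nat \<Rightarrow> ('h, 'e) mor" where
  "strip_mor P H act D F i =
     foldr (mor_tensor P H act)
       (line_mors P H D F i 0 (left_at D i) @
        piece_mors P H D F i @
        line_mors P H D F i (length (left_at D i) + length (piece_top (piece_at D i))) (right_at D i))
       (mor_id P \<one>\<^bsub>H\<^esub>)"

definition evaluation ::
  "('e, 'k) monoid_scheme \<Rightarrow> ('h, 'm) monoid_scheme \<Rightarrow> ('h \<Rightarrow> 'e \<Rightarrow> 'e) \<Rightarrow> diagram \<Rightarrow>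
   ('h, 'e) colouring \<Rightarrow> ('h, 'e) mor" where
  "evaluation P H act D F =
     foldl (mor_comp P) (mor_id P (fst F (top_arc D))) (map (strip_mor P H act D F) [0..<length D])"

definition mor_elem :: "('h, 'e) mor \<Rightarrow> 'e" where
  "mor_elem F = fst (snd F)"

text \<open>The matrix element \<open>\<langle>a|I\<^sub>\<Phi>(L)|b\<rangle>\<close>. All evaluations occurring in it have source \<open>a\<close> and
  target \<open>b\<close>, so they are recorded by their elements only. The integral group ring is, additively,
  the group \<open>'e \<Rightarrow>\<^sub>0 int\<close> of formal integral combinations, with basis \<open>frag_of e\<close>.\<close>

definition state_sum ::
  "('e, 'k) monoid_scheme \<Rightarrow> ('h, 'm) monoid_scheme \<Rightarrow> ('e \<Rightarrow> 'h) \<Rightarrow> ('h \<Rightarrow> 'e \<Rightarrow> 'e) \<Rightarrow>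
   ('h \<Rightarrow> 'h \<Rightarrow> 'e) \<Rightarrow> ('h \<Rightarrow> 'h \<Rightarrow> 'e) \<Rightarrow> diagram \<Rightarrow> 'h \<Rightarrow> 'h \<Rightarrow> 'e \<Rightarrow>\<^sub>0 int" where
  "state_sum P H \<mu> act \<psi> \<phi> D a b =
     (\<Sum>F\<in>reidemeister_colourings P H \<mu> \<psi> \<phi> D a b. frag_of (mor_elem (evaluation P H act D F)))"


section \<open>Knot group, meridian, longitude and its lift\<close>

definition wirtinger_relations :: "diagram \<Rightarrow> (arc word \<times> arc word) set" where
  "wirtinger_relations D =
     (\<lambda>i. let X = over_arc D i; Y = under_bot D i; Z = under_top D i in
        if piece_at D i = XPos
        then ([(Z, True), (X, True)], [(X, True), (Y, True)])
        else ([(X, True), (Z, True)], [(Y, True), (X, True)])) ` crossings D"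

text \<open>\<open>\<pi>\<close> is the knot group of the closure of \<open>D\<close>, with Wirtinger generators \<open>g a\<close>. The end arcs of
  \<open>D\<close> are not identified: the relation between their generators holds automatically.\<close>

definition wirtinger_group :: "diagram \<Rightarrow> ('p, 'm) monoid_scheme \<Rightarrow> (arc \<Rightarrow> 'p) \<Rightarrow> bool" where
  "wirtinger_group D \<pi> g \<longleftrightarrow> has_presentation \<pi> g (arcs D) (wirtinger_relations D)"

definition meridian :: "diagram \<Rightarrow> (arc \<Rightarrow> 'p) \<Rightarrow> 'p" where
  "meridian D g = g (top_arc D)"

text \<open>The crossing at which the arc \<open>a\<close> ends, and the arcs in the order in which they are met from
  the top (counted from \<open>0\<close>).\<close>

definition exit_crossing :: "diagram \<Rightarrow> arc \<Rightarrow> nat" where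
  "exit_crossing D a = (THE i. i \<in> crossings D \<and> under_top D i = a)"

fun nth_arc :: "diagram \<Rightarrow> nat \<Rightarrow> arc" where
  "nth_arc D 0 = top_arc D"
| "nth_arc D (Suc n) = under_bot D (exit_crossing D (nth_arc D n))"

fun partial_longitude :: "diagram \<Rightarrow> ('p, 'm) monoid_scheme \<Rightarrow> (arc \<Rightarrow> 'p) \<Rightarrow> nat \<Rightarrow> 'p" where
  "partial_longitude D \<pi> g 0 = \<one>\<^bsub>\<pi>\<^esub>"
| "partial_longitude D \<pi> g (Suc n) =
     (let i = exit_crossing D (nth_arc D n) in
      partial_longitude D \<pi> g n
        \<otimes>\<^bsub>\<pi>\<^esub> g (nth_arc D n) [^]\<^bsub>\<pi>\<^esub> (- crossing_sign D i)
        \<otimes>\<^bsub>\<pi>\<^esub> g (over_arc D i) [^]\<^bsub>\<pi>\<^esub> crossing_sign D i)"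

definition longitude :: "diagram \<Rightarrow> ('p, 'm) monoid_scheme \<Rightarrow> (arc \<Rightarrow> 'p) \<Rightarrow> 'p" where
  "longitude D \<pi> g = partial_longitude D \<pi> g (card (arcs D) - 1)"

definition arc_longitude :: "diagram \<Rightarrow> ('p, 'm) monoid_scheme \<Rightarrow> (arc \<Rightarrow> 'p) \<Rightarrow> arc \<Rightarrow> 'p" where
  "arc_longitude D \<pi> g a = partial_longitude D \<pi> g (THE n. n < card (arcs D) \<and> nth_arc D n = a)"

text \<open>The colouring of \<open>D\<close> by partial longitudes, using \<open>\<pi> \<otimes> \<pi> \<rightarrow> \<pi>\<close>.\<close>

definition longitude_colouring ::
  "diagram \<Rightarrow> ('p, 'm) monoid_scheme \<Rightarrow> (arc \<Rightarrow> 'p) \<Rightarrow> ('p, ('p \<times> 'p) word set) colouring" where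
  "longitude_colouring D \<pi> g =
     (\<lambda>a\<in>arcs D. arc_longitude D \<pi> g a,
      \<lambda>i\<in>crossings D.
        let m = meridian D g;
            L = arc_longitude D \<pi> g (over_arc D i);
            M = arc_longitude D \<pi> g (under_bot D i) in
        if piece_at D i = XPos
        then psi_pair (tensor_square \<pi>) \<pi> (tensor_braiding \<pi>) m L M
        else phi_pair \<pi> (tensor_braiding \<pi>) m L M)"

text \<open>The lift \<open>l\<^sub>D \<in> \<pi> \<otimes> \<pi>\<close> of \<open>longitude D \<pi> g\<close>: the evaluation is a morphism from \<open>1\<close> to the
  longitude.\<close>

definition longitude_lift ::
  "diagram \<Rightarrow> ('p, 'm) monoid_scheme \<Rightarrow> (arc \<Rightarrow> 'p) \<Rightarrow> ('p \<times> 'p) word set" where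
  "longitude_lift D \<pi> g =
     mor_elem (evaluation (tensor_square \<pi>) \<pi>
       (braided_act (tensor_square \<pi>) \<pi> (tensor_delta \<pi>) (tensor_braiding \<pi>)) D
       (longitude_colouring D \<pi> g))"

end

theory Submission
  imports Defs
begin

text \<open>The partial longitudes \<open>l\<^sub>a\<close> satisfy \<open>g\<^sub>a = l\<^sub>a\<^sup>-\<^sup>1 m l\<^sub>a\<close>. Hence a colouring \<open>c\<close> of
  the arcs with \<open>c = 1\<close> at the top comes from a unique morphism \<open>f\<close> with \<open>f m = x\<close>: put
  \<open>f g\<^sub>a = (c a)\<^sup>-\<^sup>1 x (c a)\<close>, and recover \<open>c a = f l\<^sub>a\<close>. Since \<open>(f, hat f)\<close> is a morphism of braided
  crossed modules, it carries the evaluation of the colouring by partial longitudes to that of \<open>c\<close>.\<close>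

section \<open>Groups given by generators and relations\<close>

text \<open>Two things lie behind this. The first is the choice of \<open>psi_pair\<close> and
  \<open>phi_pair\<close>: their crossing rules, solved for the outgoing under arc, become Y = inv x
  Z inv X x X at a positive and Y = x Z inv X inv x X at a negative crossing. This is exactly the
  recursion of the partial longitudes once their generators are written as conjugates of
  \<open>m\<close>, with \<open>x\<close> in place of \<open>m\<close>; hence both are propagated
  from the same start, the label 1 at the top. The second is the obstacle that shapes the longest
  part. Longitudes need the arcs as a list, and \<open>exit_crossing\<close> and
  \<open>arc_longitude\<close> are definite descriptions, whereas a diagram is only known to be
  connected as an undirected graph of points. The joins are therefore oriented along the strands:
  oriented steps neither branch nor merge, and a finite graph of this kind, reachable from a vertex
  without predecessor, is a path. On the algebraic side, \<open>hat\<close> respects the tensor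
  relations because the bracket is invariant under the derived action
  (\<open>act_br\<close>).\<close>

declare in_listsI [rule del] in_listsD [rule del]

text \<open>Together with \<open>m_assoc\<close>, which nests products to the right, these let simp
  cancel inside longer products; most group computations below rest on that.\<close>

lemma (in group) inv_mult_left [simp]:
  "a \<in> carrier G \<Longrightarrow> b \<in> carrier G \<Longrightarrow> inv a \<otimes> (a \<otimes> b) = b"
  "a \<in> carrier G \<Longrightarrow> b \<in> carrier G \<Longrightarrow> a \<otimes> (inv a \<otimes> b) = b"
  by (simp_all flip: m_assoc)

definition word_value :: "('h, 'm) monoid_scheme \<Rightarrow> ('s \<Rightarrow> 'h) \<Rightarrow> 's word \<Rightarrow> 'h" where
  "word_value H k w = foldr (\<lambda>(s, b) a. (if b then k s else inv\<^bsub>H\<^esub> (k s)) \<otimes>\<^bsub>H\<^esub> a) w \<one>\<^bsub>H\<^esub>"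

lemma word_value_Nil [simp]: "word_value H k [] = \<one>\<^bsub>H\<^esub>"
  by (simp add: word_value_def)

lemma word_value_Cons [simp]:
  "word_value H k ((s, b) # w) = (if b then k s else inv\<^bsub>H\<^esub> (k s)) \<otimes>\<^bsub>H\<^esub> word_value H k w"
  by (simp add: word_value_def)

definition inverse_word :: "'s word \<Rightarrow> 's word" where
  "inverse_word w = rev (map (\<lambda>(s, b). (s, \<not> b)) w)"

lemma inverse_word_in_words:
  assumes "w \<in> lists (S \<times> UNIV)"
  shows "inverse_word w \<in> lists (S \<times> UNIV)"
  using assms by (auto simp: inverse_word_def lists_eq_set)

lemma inverse_word_cancel:
  assumes "w \<in> lists (S \<times> UNIV)"
  shows "pres_eq S R (inverse_word w @ w) []"
  using assms
proof (induction w)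
  case Nil
  then show ?case by (simp add: inverse_word_def pres_eq.refl)
next
  case (Cons a w)
  obtain s b where a: "a = (s, b)" by (cases a)
  with Cons.hyps have s: "s \<in> S" by auto
  have w: "pres_eq S R w w" "pres_eq S R (inverse_word w) (inverse_word w)"
    using Cons.hyps by (simp_all add: pres_eq.refl inverse_word_in_words)
  \<comment> \<open>The head letter and its inverse meet in the middle of the word, so
    \<open>cancel\<close> applies there, with sign \<not> b.\<close>
  have "pres_eq S R (inverse_word w @ [(s, \<not> b), (s, \<not> \<not> b)] @ w) (inverse_word w @ [] @ w)"
    using s w by (intro pres_eq.append pres_eq.cancel)
  then show ?case
    using Cons.IH by (auto simp: a inverse_word_def intro: pres_eq.trans)
qed

text \<open>The assumption keeps \<open>pres_eq\<close> inside the words over \<open>S\<close>,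
  which makes \<open>pres_rel\<close> an equivalence on that set.\<close>

locale presentation =
  fixes S :: "'s set" and R :: "('s word \<times> 's word) set"
  assumes relators: "R \<subseteq> lists (S \<times> UNIV) \<times> lists (S \<times> UNIV)"
begin

abbreviation "W \<equiv> lists (S \<times> UNIV) :: 's word set"
abbreviation "PG \<equiv> presented_group S R"
abbreviation "cls w \<equiv> pres_rel S R `` {w}"

lemma pres_eq_words: "pres_eq S R u v \<Longrightarrow> u \<in> W \<and> v \<in> W"
  by (induction rule: pres_eq.induct) (use relators in auto)

lemma equiv_pres_rel: "equiv W (pres_rel S R)"
  by (intro equivI refl_onI symI transI)
    (auto simp: pres_rel_def dest: pres_eq_words intro: pres_eq.intros)

lemma cls_eq_iff: "u \<in> W \<Longrightarrow> v \<in> W \<Longrightarrow> cls u = cls v \<longleftrightarrow> pres_eq S R u v"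
  using eq_equiv_class_iff[OF equiv_pres_rel] by (auto simp: pres_rel_def)

lemma cls_in_carrier: "w \<in> W \<Longrightarrow> cls w \<in> carrier PG"
  by (simp add: presented_group_def quotientI)

lemma carrier_presented_group_cases:
  assumes "A \<in> carrier PG"
  obtains w where "w \<in> W" "A = cls w"
  using assms by (simp add: presented_group_def) (metis quotientE)

lemma one_presented_group: "\<one>\<^bsub>PG\<^esub> = cls []"
  by (simp add: presented_group_def)

lemma mult_cls:
  assumes "u \<in> W" "v \<in> W"
  shows "cls u \<otimes>\<^bsub>PG\<^esub> cls v = cls (u @ v)"
proof -
  have "cls (u' @ v') = cls (u @ v)" if "u' \<in> cls u" "v' \<in> cls v" for u' v'
  proof -
    have "pres_eq S R (u @ v) (u' @ v')"
      using that by (auto simp: pres_rel_def intro: pres_eq.append)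
    then show ?thesis
      by (metis cls_eq_iff pres_eq_words)
  qed
  moreover have "u \<in> cls u" "v \<in> cls v"
    using assms by (auto simp: pres_rel_def intro: pres_eq.refl)
  ultimately have "(\<Union>u'\<in>cls u. \<Union>v'\<in>cls v. cls (u' @ v')) = cls (u @ v)"
    by blast
  then show ?thesis
    by (simp add: presented_group_def)
qed

lemma group_presented_group: "group PG"
proof (intro groupI)
  fix A assume "A \<in> carrier PG"
  then obtain w where w: "w \<in> W" "A = cls w" by (rule carrier_presented_group_cases)
  then have "cls (inverse_word w) \<otimes>\<^bsub>PG\<^esub> A = \<one>\<^bsub>PG\<^esub>"
    by (simp add: mult_cls inverse_word_in_words one_presented_group cls_eq_iff
        inverse_word_cancel)
  then show "\<exists>B\<in>carrier PG. B \<otimes>\<^bsub>PG\<^esub> A = \<one>\<^bsub>PG\<^esub>"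
    using w by (auto intro!: cls_in_carrier inverse_word_in_words)
qed (auto simp: one_presented_group mult_cls intro: cls_in_carrier
      elim!: carrier_presented_group_cases)

lemma pres_gen_in_carrier: "s \<in> S \<Longrightarrow> pres_gen S R s \<in> carrier PG"
  by (simp add: pres_gen_def cls_in_carrier)

lemma inv_pres_gen:
  assumes "s \<in> S"
  shows "inv\<^bsub>PG\<^esub> (pres_gen S R s) = cls [(s, False)]"
proof -
  interpret group PG by (rule group_presented_group)
  have "cls [(s, False)] \<otimes>\<^bsub>PG\<^esub> pres_gen S R s = \<one>\<^bsub>PG\<^esub>"
    using assms pres_eq.cancel[of s S R False]
    by (simp add: pres_gen_def mult_cls one_presented_group cls_eq_iff)
  then show ?thesis
    using assms by (intro inv_equality) (auto simp: pres_gen_in_carrier cls_in_carrier)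
qed

text \<open>With \<open>hom_word_value\<close> this computes a morphism on any class from its values
  on the generators, the source of all uniqueness statements.\<close>

lemma cls_eq_word_value:
  assumes "w \<in> W"
  shows "cls w = word_value PG (pres_gen S R) w"
  using assms
proof (induction w)
  case Nil
  then show ?case by (simp add: one_presented_group)
next
  case (Cons a w)
  obtain s b where a: "a = (s, b)" by (cases a)
  with Cons.hyps have s: "s \<in> S" by auto
  have "cls (a # w) = cls [(s, b)] \<otimes>\<^bsub>PG\<^esub> cls w"
    using Cons.hyps s by (simp add: mult_cls a)
  moreover have "cls [(s, b)] = (if b then pres_gen S R s else inv\<^bsub>PG\<^esub> (pres_gen S R s))"
    using s by (simp add: inv_pres_gen) (simp add: pres_gen_def)
  ultimately show ?case
    using Cons.IH by (simp add: a)
qed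

end

section \<open>Values of words and the universal property\<close>

lemma word_value_closed:
  assumes "group H" "k \<in> S \<rightarrow> carrier H" "w \<in> lists (S \<times> UNIV)"
  shows "word_value H k w \<in> carrier H"
proof -
  interpret group H by fact
  show ?thesis
    using assms(3) by (induction w) (use assms(2) in \<open>auto simp: Pi_iff\<close>)
qed

lemma word_value_append:
  assumes "group H" "k \<in> S \<rightarrow> carrier H" "u \<in> lists (S \<times> UNIV)" "v \<in> lists (S \<times> UNIV)"
  shows "word_value H k (u @ v) = word_value H k u \<otimes>\<^bsub>H\<^esub> word_value H k v"
proof -
  interpret group H by fact
  note closed = word_value_closed[OF assms(1,2)]
  show ?thesis
    using assms(3)
    by (induction u) (use assms(2,4) in \<open>auto simp: closed m_assoc Pi_iff\<close>)
qed

lemma hom_word_value: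
  assumes "group H" "group K" "h \<in> hom H K" "k \<in> S \<rightarrow> carrier H" "w \<in> lists (S \<times> UNIV)"
  shows "h (word_value H k w) = word_value K (h \<circ> k) w"
proof -
  interpret group_hom H K h
    using assms(1-3) by (simp add: group_hom_def group_hom_axioms_def)
  note closed = word_value_closed[OF assms(1,4)]
  show ?thesis
    using assms(5) by (induction w) (use assms(4) in \<open>auto simp: closed Pi_iff\<close>)
qed

lemma word_value_cong:
  assumes "\<And>s. s \<in> S \<Longrightarrow> k s = k' s" "w \<in> lists (S \<times> UNIV)"
  shows "word_value H k w = word_value H k' w"
  using assms(2) by (induction w) (use assms(1) in auto)

context presentation
begin

lemma word_value_pres_eq:
  assumes "group H" "k \<in> S \<rightarrow> carrier H"
    and rels: "\<And>u v. (u, v) \<in> R \<Longrightarrow> word_value H k u = word_value H k v"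
    and "pres_eq S R u v"
  shows "word_value H k u = word_value H k v"
proof -
  interpret group H by fact
  show ?thesis
    using assms(4)
  proof (induction rule: pres_eq.induct)
    case (append u u' v v')
    then show ?case
      by (metis assms(1,2) pres_eq_words word_value_append)
  qed (use assms(2) rels in \<open>auto simp: Pi_iff\<close>)
qed

lemma ex_hom_on_gens:
  assumes "group H" "k \<in> S \<rightarrow> carrier H"
    and rels: "\<And>u v. (u, v) \<in> R \<Longrightarrow> word_value H k u = word_value H k v"
  shows "\<exists>h \<in> hom PG H. \<forall>s\<in>S. h (pres_gen S R s) = k s"
proof -
  interpret group H by fact
  \<comment> \<open>The choice of representative does not matter: by
    \<open>word_value_pres_eq\<close> all words of a class have the same value.\<close>
  define h where "h A = word_value H k (SOME w. w \<in> A)" for A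
  have h: "h (cls w) = word_value H k w" if "w \<in> W" for w
  proof -
    have "w \<in> cls w"
      using that by (auto simp: pres_rel_def intro: pres_eq.refl)
    then have "(SOME w'. w' \<in> cls w) \<in> cls w"
      by (rule someI)
    then show ?thesis
      unfolding h_def using word_value_pres_eq[OF assms] by (force simp: pres_rel_def)
  qed
  show ?thesis
  proof (intro bexI homI ballI)
    show "h (pres_gen S R s) = k s" if "s \<in> S" for s
      using that assms(2) h[of "[(s, True)]"] by (auto simp: pres_gen_def Pi_iff)
    show "h A \<in> carrier H" if "A \<in> carrier PG" for A
      using that by (rule carrier_presented_group_cases)
        (simp add: h word_value_closed[OF assms(1,2)])
    show "h (A \<otimes>\<^bsub>PG\<^esub> B) = h A \<otimes>\<^bsub>H\<^esub> h B"
      if "A \<in> carrier PG" "B \<in> carrier PG" for A B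
      using that by (elim carrier_presented_group_cases)
        (simp add: mult_cls h word_value_append[OF assms(1,2)])
  qed
qed

lemma hom_eq_on_gens:
  assumes "group H" "h \<in> hom PG H" "h' \<in> hom PG H"
    and "\<And>s. s \<in> S \<Longrightarrow> h (pres_gen S R s) = h' (pres_gen S R s)"
    and "A \<in> carrier PG"
  shows "h A = h' A"
proof -
  obtain w where w: "w \<in> W" "A = cls w"
    using assms(5) by (rule carrier_presented_group_cases)
  have gens: "pres_gen S R \<in> S \<rightarrow> carrier PG"
    by (auto intro: pres_gen_in_carrier)
  have "h A = word_value H (h \<circ> pres_gen S R) w" "h' A = word_value H (h' \<circ> pres_gen S R) w"
    using w by (simp_all add: cls_eq_word_value
        hom_word_value[OF group_presented_group assms(1) _ gens] assms(2,3))
  then show ?thesis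
    using word_value_cong[OF _ w(1), of "h \<circ> pres_gen S R" "h' \<circ> pres_gen S R" H] assms(4)
    by simp
qed

lemma hom_on_gens_hom:
  assumes "group H" "k \<in> S \<rightarrow> carrier H"
    and rels: "\<And>u v. (u, v) \<in> R \<Longrightarrow> word_value H k u = word_value H k v"
  shows "hom_on_gens S R H k \<in> hom PG H"
    and "s \<in> S \<Longrightarrow> hom_on_gens S R H k (pres_gen S R s) = k s"
proof -
  interpret PG: group PG by (rule group_presented_group)
  let ?P = "\<lambda>h. h \<in> hom PG H \<inter> extensional (carrier PG) \<and> (\<forall>s\<in>S. h (pres_gen S R s) = k s)"
  obtain h0 where h0: "h0 \<in> hom PG H" "\<forall>s\<in>S. h0 (pres_gen S R s) = k s"
    using ex_hom_on_gens[OF assms] by blast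
  \<comment> \<open>Generators determine a morphism on the carrier only; restricting fixes the
    values elsewhere, as the definite description in \<open>hom_on_gens\<close> demands.\<close>
  define h where "h = restrict h0 (carrier PG)"
  have "?P h"
    using h0 by (auto simp: h_def hom_def Pi_iff pres_gen_in_carrier)
  moreover have "h1 = h2" if "?P h1" "?P h2" for h1 h2
  proof (rule extensionalityI)
    show "h1 A = h2 A" if "A \<in> carrier PG" for A
      using \<open>?P h1\<close> \<open>?P h2\<close> that by - (rule hom_eq_on_gens[OF assms(1)], simp_all)
  qed (use that in auto)
  ultimately have "\<exists>!h. ?P h"
    by (intro ex1I)
  then have "?P (THE h. ?P h)"
    by (rule theI')
  then have "?P (hom_on_gens S R H k)"
    by (simp add: hom_on_gens_def)
  then show "hom_on_gens S R H k \<in> hom PG H"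
    and "s \<in> S \<Longrightarrow> hom_on_gens S R H k (pres_gen S R s) = k s"
    by auto
qed

end

section \<open>Groups with a given presentation\<close>

locale presented_by = presentation S R
  for S :: "'s set" and R + fixes G :: "('h, 'm) monoid_scheme" and g :: "'s \<Rightarrow> 'h"
  assumes pres: "has_presentation G g S R"
begin

lemma is_group: "group G"
  using pres by (simp add: has_presentation_def)

lemma gens_in_carrier: "g \<in> S \<rightarrow> carrier G"
proof
  fix s assume "s \<in> S"
  obtain \<theta> where "\<theta> \<in> iso PG G" "\<forall>s\<in>S. \<theta> (pres_gen S R s) = g s"
    using pres by (auto simp: has_presentation_def)
  then show "g s \<in> carrier G"
    using \<open>s \<in> S\<close> pres_gen_in_carrier[OF \<open>s \<in> S\<close>] by (force simp: iso_def hom_def Pi_iff)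
qed

lemma word_value_rel:
  assumes "(u, v) \<in> R"
  shows "word_value G g u = word_value G g v"
proof -
  obtain \<theta> where \<theta>: "\<theta> \<in> hom PG G" "\<forall>s\<in>S. \<theta> (pres_gen S R s) = g s"
    using pres by (auto simp: has_presentation_def iso_def)
  have gens: "pres_gen S R \<in> S \<rightarrow> carrier PG"
    by (auto intro: pres_gen_in_carrier)
  have uv: "u \<in> W" "v \<in> W" "pres_eq S R u v"
    using assms relators by (auto intro: pres_eq.rel)
  have "\<theta> (cls w) = word_value G g w" if "w \<in> W" for w
    using that \<theta>(2) by (simp add: cls_eq_word_value
        hom_word_value[OF group_presented_group is_group \<theta>(1) gens])
      (rule word_value_cong, auto)
  then show ?thesis
    using uv by (metis cls_eq_iff)
qed

lemma ex_hom:
  assumes "group H" "k \<in> S \<rightarrow> carrier H"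
    and rels: "\<And>u v. (u, v) \<in> R \<Longrightarrow> word_value H k u = word_value H k v"
  shows "\<exists>f \<in> hom G H \<inter> extensional (carrier G). \<forall>s\<in>S. f (g s) = k s"
proof -
  interpret PG: group PG by (rule group_presented_group)
  obtain \<theta> where \<theta>: "\<theta> \<in> iso PG G" "\<forall>s\<in>S. \<theta> (pres_gen S R s) = g s"
    using pres by (auto simp: has_presentation_def)
  obtain h where h: "h \<in> hom PG H" "\<forall>s\<in>S. h (pres_gen S R s) = k s"
    using ex_hom_on_gens[OF assms] by blast
  define \<eta> where "\<eta> = inv_into (carrier PG) \<theta>"
  have "\<eta> \<in> hom G PG"
    using PG.iso_set_sym[OF \<theta>(1)] by (auto simp: \<eta>_def iso_def)
  then have "h \<circ> \<eta> \<in> hom G H"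
    using h(1) by (rule hom_compose)
  then have "restrict (h \<circ> \<eta>) (carrier G) \<in> hom G H \<inter> extensional (carrier G)"
    by (simp add: group.restrict_hom_iff is_group hom_def Pi_iff group.is_monoid monoid.m_closed)
  moreover have "restrict (h \<circ> \<eta>) (carrier G) (g s) = k s" if "s \<in> S" for s
  proof -
    have "\<eta> (g s) = pres_gen S R s"
      using that \<theta> pres_gen_in_carrier[OF that]
      by (metis (no_types, lifting) Group.iso_def \<eta>_def bij_betw_imp_inj_on inv_into_f_f mem_Collect_eq)
    then show ?thesis
      using that h(2) gens_in_carrier by auto
  qed
  ultimately show ?thesis by blast
qed

lemma hom_eq:
  assumes "group H" "f \<in> hom G H \<inter> extensional (carrier G)" "f' \<in> hom G H \<inter> extensional (carrier G)"
    and "\<And>s. s \<in> S \<Longrightarrow> f (g s) = f' (g s)"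
  shows "f = f'"
proof -
  obtain \<theta> where \<theta>: "\<theta> \<in> iso PG G" "\<forall>s\<in>S. \<theta> (pres_gen S R s) = g s"
    using pres by (auto simp: has_presentation_def)
  have \<theta>': "\<theta> \<in> hom PG G"
    using \<theta>(1) by (simp add: iso_def)
  have "f y = f' y" if y: "y \<in> carrier G" for y
  proof -
    obtain A where A: "A \<in> carrier PG" "y = \<theta> A"
      using y \<theta>(1) by (auto simp: iso_def bij_betw_def)
    have "(f \<circ> \<theta>) A = (f' \<circ> \<theta>) A"
      using assms(2-4) \<theta>(2)
      by - (rule hom_eq_on_gens[OF assms(1) hom_compose[OF \<theta>'] hom_compose[OF \<theta>'] _ A(1)], auto)
    then show ?thesis by (simp add: A(2))
  qed
  then show ?thesis
    using assms(2,3) by (intro extensionalityI[of f "carrier G"]) auto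
qed

end

section \<open>Braided crossed modules\<close>

locale braided =
  fixes E :: "('e, 'k) monoid_scheme" and G :: "('h, 'n) monoid_scheme"
    and \<delta> :: "'e \<Rightarrow> 'h" and br :: "'h \<Rightarrow> 'h \<Rightarrow> 'e"
  assumes bcm: "braided_crossed_module E G \<delta> br"
begin

abbreviation "act \<equiv> braided_act E G \<delta> br"

lemma group_E: "group E" and group_G: "group G" and delta_hom: "\<delta> \<in> hom E G"
  using bcm by (simp_all add: braided_crossed_module_def)

sublocale E: group E by (rule group_E)
sublocale G: group G by (rule group_G)
sublocale delta: group_hom E G \<delta>
  by unfold_locales (rule delta_hom)

lemma br_closed [simp]: "e \<in> carrier G \<Longrightarrow> f \<in> carrier G \<Longrightarrow> br e f \<in> carrier E"
  and delta_br: "e \<in> carrier G \<Longrightarrow> f \<in> carrier G \<Longrightarrow> \<delta> (br e f) = commutator G e f"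
  and br_delta: "l \<in> carrier E \<Longrightarrow> k \<in> carrier E \<Longrightarrow> br (\<delta> l) (\<delta> k) = commutator E l k"
  and br_delta_swap: "l \<in> carrier E \<Longrightarrow> e \<in> carrier G \<Longrightarrow> br (\<delta> l) e \<otimes>\<^bsub>E\<^esub> br e (\<delta> l) = \<one>\<^bsub>E\<^esub>"
  and br_mult_left: "e \<in> carrier G \<Longrightarrow> f \<in> carrier G \<Longrightarrow> h \<in> carrier G \<Longrightarrow>
        br (e \<otimes>\<^bsub>G\<^esub> f) h = br e (f \<otimes>\<^bsub>G\<^esub> h \<otimes>\<^bsub>G\<^esub> inv\<^bsub>G\<^esub> f) \<otimes>\<^bsub>E\<^esub> br f h"
  and br_mult_right: "e \<in> carrier G \<Longrightarrow> f \<in> carrier G \<Longrightarrow> h \<in> carrier G \<Longrightarrow>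
        br e (f \<otimes>\<^bsub>G\<^esub> h) = br e f \<otimes>\<^bsub>E\<^esub> act f (br e h)"
  using bcm by (simp_all add: braided_crossed_module_def)

lemma act_closed [simp]: "e \<in> carrier G \<Longrightarrow> l \<in> carrier E \<Longrightarrow> act e l \<in> carrier E"
  by (simp add: braided_act_def)

lemma br_one_left: "e \<in> carrier G \<Longrightarrow> br \<one>\<^bsub>G\<^esub> e = \<one>\<^bsub>E\<^esub>"
  using br_mult_left[of "\<one>\<^bsub>G\<^esub>" "\<one>\<^bsub>G\<^esub>" e] by simp

text \<open>The Peiffer identity: by definition the action multiplies \<open>k\<close> by the
  bracket of the boundaries of \<open>inv k\<close> and \<open>l\<close>, which is a commutator in
  \<open>E\<close>.\<close>

lemma act_delta:
  assumes "l \<in> carrier E" "k \<in> carrier E"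
  shows "act (\<delta> l) k = l \<otimes>\<^bsub>E\<^esub> k \<otimes>\<^bsub>E\<^esub> inv\<^bsub>E\<^esub> l"
  using assms br_delta[of "inv\<^bsub>E\<^esub> k" l]
  by (simp add: braided_act_def commutator_def E.m_assoc)

text \<open>Both sides are inverse to \<open>br (\<delta> l) e\<close>: the left one by expanding
  the trivial bracket of 1 = inv d d with \<open>e\<close>, where d = \<open>\<delta> l\<close>, the
  right one by the swap axiom.\<close>

lemma br_delta_inv_swap:
  assumes "l \<in> carrier E" "e \<in> carrier G"
  shows "br (inv\<^bsub>G\<^esub> (\<delta> l)) (\<delta> l \<otimes>\<^bsub>G\<^esub> e \<otimes>\<^bsub>G\<^esub> inv\<^bsub>G\<^esub> (\<delta> l)) = br e (\<delta> l)"
proof -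
  let ?d = "\<delta> l"
  have "br (inv\<^bsub>G\<^esub> ?d) (?d \<otimes>\<^bsub>G\<^esub> e \<otimes>\<^bsub>G\<^esub> inv\<^bsub>G\<^esub> ?d) \<otimes>\<^bsub>E\<^esub> br ?d e = \<one>\<^bsub>E\<^esub>"
    using br_mult_left[of "inv\<^bsub>G\<^esub> ?d" ?d e] assms by (simp add: br_one_left)
  moreover have "inv\<^bsub>E\<^esub> (br ?d e) = br e ?d"
    using assms br_delta_swap[of l e] by (metis E.inv_equality E.inv_inv br_closed delta.hom_closed)
  ultimately show ?thesis
    using assms by (metis E.inv_equality G.inv_closed G.m_closed br_closed delta.hom_closed E.inv_inv)
qed

text \<open>The two expansions of \<open>br (inv d) (d e)\<close>, with \<open>d = \<delta> l\<close>, agree.\<close>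

lemma act_delta_br_inv:
  assumes "l \<in> carrier E" "e \<in> carrier G"
  shows "act (\<delta> l) (br (inv\<^bsub>G\<^esub> (\<delta> l)) e) =
    br (inv\<^bsub>G\<^esub> (\<delta> l)) (\<delta> l \<otimes>\<^bsub>G\<^esub> e \<otimes>\<^bsub>G\<^esub> inv\<^bsub>G\<^esub> (\<delta> l))"
proof -
  let ?d = "\<delta> l" and ?d' = "inv\<^bsub>G\<^esub> (\<delta> l)"
  let ?e = "?d \<otimes>\<^bsub>G\<^esub> e \<otimes>\<^bsub>G\<^esub> ?d'"
  have "br ?d' ?d = \<one>\<^bsub>E\<^esub>"
    using assms br_delta[of "inv\<^bsub>E\<^esub> l" l] by (simp add: commutator_def E.m_assoc)
  moreover have "br ?d' (?d \<otimes>\<^bsub>G\<^esub> e) = br ?d' ?d \<otimes>\<^bsub>E\<^esub> act ?d (br ?d' e)"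
    using assms by (simp add: br_mult_right)
  moreover have "br ?d' (?e \<otimes>\<^bsub>G\<^esub> ?d) = br ?d' ?e \<otimes>\<^bsub>E\<^esub> act ?e (br ?d' ?d)"
    using assms by (intro br_mult_right) auto
  moreover have "?e \<otimes>\<^bsub>G\<^esub> ?d = ?d \<otimes>\<^bsub>G\<^esub> e"
    using assms by (simp add: G.m_assoc)
  ultimately show ?thesis
    using assms by (simp add: braided_act_def br_one_left)
qed

text \<open>The bracket is invariant under the derived action. Reading e f as (e f inv e) e gives
  two expansions of the bracket of e f with h; cancelling \<open>br e h\<close> leaves the
  right-hand side as \<open>br e (\<delta> l)\<close> times \<open>l\<close>, with
  \<open>l = br f h\<close>.\<close>

lemma act_br:
  assumes "e \<in> carrier G" "f \<in> carrier G" "h \<in> carrier G"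
  shows "act e (br f h) = br (e \<otimes>\<^bsub>G\<^esub> f \<otimes>\<^bsub>G\<^esub> inv\<^bsub>G\<^esub> e) (e \<otimes>\<^bsub>G\<^esub> h \<otimes>\<^bsub>G\<^esub> inv\<^bsub>G\<^esub> e)"
proof -
  define l where "l = br f h"
  let ?d = "\<delta> l" and ?d' = "inv\<^bsub>G\<^esub> (\<delta> l)"
  let ?f = "e \<otimes>\<^bsub>G\<^esub> f \<otimes>\<^bsub>G\<^esub> inv\<^bsub>G\<^esub> e" and ?h = "e \<otimes>\<^bsub>G\<^esub> h \<otimes>\<^bsub>G\<^esub> inv\<^bsub>G\<^esub> e"
  have l: "l \<in> carrier E"
    using assms by (simp add: l_def)
  have d: "f \<otimes>\<^bsub>G\<^esub> h \<otimes>\<^bsub>G\<^esub> inv\<^bsub>G\<^esub> f = ?d \<otimes>\<^bsub>G\<^esub> h"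
    using assms by (simp add: l_def delta_br commutator_def G.m_assoc)
  have "br ?f ?h \<otimes>\<^bsub>E\<^esub> br e h = br (e \<otimes>\<^bsub>G\<^esub> f) h"
    using assms br_mult_left[of ?f e h] by (simp add: G.m_assoc)
  also have "\<dots> = br e (?d \<otimes>\<^bsub>G\<^esub> h) \<otimes>\<^bsub>E\<^esub> l"
    using assms by (simp add: br_mult_left d flip: l_def)
  also have "\<dots> = br e ?d \<otimes>\<^bsub>E\<^esub> l \<otimes>\<^bsub>E\<^esub> br e h"
    using assms l by (simp add: br_mult_right act_delta E.m_assoc)
  finally have "br ?f ?h = br e ?d \<otimes>\<^bsub>E\<^esub> l"
    using assms l by simp
  \<comment> \<open>The boundary of \<open>l\<close> moves from the right argument to the left one,
    where it stands inverted as in the definition of \<open>act e l\<close>; the outer action of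
    \<open>?d\<close> is conjugation by \<open>l\<close>.\<close>
  also have "\<dots> = act ?d (br ?d' e) \<otimes>\<^bsub>E\<^esub> l"
    using assms l by (simp add: act_delta_br_inv br_delta_inv_swap)
  also have "\<dots> = act e l"
    using assms l by (simp add: act_delta E.m_assoc) (simp add: braided_act_def)
  finally show ?thesis
    by (simp add: l_def)
qed

end

section \<open>The non-abelian tensor square\<close>

lemma presentation_tensor_square:
  assumes "group \<pi>"
  shows "presentation (carrier \<pi> \<times> carrier \<pi>) (tensor_relations \<pi>)"
proof -
  interpret group \<pi> by fact
  show ?thesis
    by unfold_locales (auto simp: tensor_relations_def)
qed

lemma tensor_hom_hom:
  assumes "group \<pi>" "group H"
    and k: "\<And>y z. y \<in> carrier \<pi> \<Longrightarrow> z \<in> carrier \<pi> \<Longrightarrow> k y z \<in> carrier H"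
    and "\<And>g h z. g \<in> carrier \<pi> \<Longrightarrow> h \<in> carrier \<pi> \<Longrightarrow> z \<in> carrier \<pi> \<Longrightarrow>
      k (g \<otimes>\<^bsub>\<pi>\<^esub> h) z =
      k (g \<otimes>\<^bsub>\<pi>\<^esub> h \<otimes>\<^bsub>\<pi>\<^esub> inv\<^bsub>\<pi>\<^esub> g) (g \<otimes>\<^bsub>\<pi>\<^esub> z \<otimes>\<^bsub>\<pi>\<^esub> inv\<^bsub>\<pi>\<^esub> g) \<otimes>\<^bsub>H\<^esub> k g z"
    and "\<And>g h z. g \<in> carrier \<pi> \<Longrightarrow> h \<in> carrier \<pi> \<Longrightarrow> z \<in> carrier \<pi> \<Longrightarrow>
      k g (h \<otimes>\<^bsub>\<pi>\<^esub> z) =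
      k g h \<otimes>\<^bsub>H\<^esub> k (h \<otimes>\<^bsub>\<pi>\<^esub> g \<otimes>\<^bsub>\<pi>\<^esub> inv\<^bsub>\<pi>\<^esub> h) (h \<otimes>\<^bsub>\<pi>\<^esub> z \<otimes>\<^bsub>\<pi>\<^esub> inv\<^bsub>\<pi>\<^esub> h)"
  shows "tensor_hom \<pi> H k \<in> hom (tensor_square \<pi>) H"
    and "y \<in> carrier \<pi> \<Longrightarrow> z \<in> carrier \<pi> \<Longrightarrow> tensor_hom \<pi> H k (tensor \<pi> y z) = k y z"
proof -
  interpret \<pi>: group \<pi> by fact
  interpret H: group H by fact
  interpret presentation "carrier \<pi> \<times> carrier \<pi>" "tensor_relations \<pi>"
    by (rule presentation_tensor_square) fact
  have "(\<lambda>(y, z). k y z) \<in> carrier \<pi> \<times> carrier \<pi> \<rightarrow> carrier H"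
    using k by auto
  moreover have "word_value H (\<lambda>(y, z). k y z) u = word_value H (\<lambda>(y, z). k y z) v"
    if "(u, v) \<in> tensor_relations \<pi>" for u v
    using that by (auto simp: tensor_relations_def k intro: assms(4,5))
  ultimately show "tensor_hom \<pi> H k \<in> hom (tensor_square \<pi>) H"
    and "y \<in> carrier \<pi> \<Longrightarrow> z \<in> carrier \<pi> \<Longrightarrow> tensor_hom \<pi> H k (tensor \<pi> y z) = k y z"
    unfolding tensor_hom_def tensor_square_def tensor_def
    using hom_on_gens_hom[OF assms(2)] by force+
qed

locale braided_hom = braided E G \<delta> br + f: group_hom \<pi> G f
  for E G \<delta> br and \<pi> :: "('p, 'q) monoid_scheme" and f
begin

abbreviation "T \<equiv> tensor_square \<pi>"
abbreviation "Tact \<equiv> braided_act T \<pi> (tensor_delta \<pi>) (tensor_braiding \<pi>)"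

sublocale T: presentation "carrier \<pi> \<times> carrier \<pi>" "tensor_relations \<pi>"
  by (rule presentation_tensor_square) unfold_locales

sublocale T: group T
  unfolding tensor_square_def by (rule T.group_presented_group)

lemma tensor_in_carrier [simp]:
  "y \<in> carrier \<pi> \<Longrightarrow> z \<in> carrier \<pi> \<Longrightarrow> tensor \<pi> y z \<in> carrier T"
  unfolding tensor_square_def tensor_def by (simp add: T.pres_gen_in_carrier)

text \<open>Swapping the arguments and inverting exchanges the two kinds of relation: the first
  tensor relation becomes expansion of \<open>br\<close> on the right, rewritten by
  \<open>act_br\<close>, and the second becomes expansion on the left.\<close>

lemma hat_hom: "hat \<pi> E br f \<in> hom T E"
  and hat_tensor: "y \<in> carrier \<pi> \<Longrightarrow> z \<in> carrier \<pi> \<Longrightarrow>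
    hat \<pi> E br f (tensor \<pi> y z) = inv\<^bsub>E\<^esub> (br (f z) (f y))"
proof -
  have "inv\<^bsub>E\<^esub> (br (f c) (f (a \<otimes>\<^bsub>\<pi>\<^esub> b))) =
      inv\<^bsub>E\<^esub> (br (f (a \<otimes>\<^bsub>\<pi>\<^esub> c \<otimes>\<^bsub>\<pi>\<^esub> inv\<^bsub>\<pi>\<^esub> a)) (f (a \<otimes>\<^bsub>\<pi>\<^esub> b \<otimes>\<^bsub>\<pi>\<^esub> inv\<^bsub>\<pi>\<^esub> a)))
      \<otimes>\<^bsub>E\<^esub> inv\<^bsub>E\<^esub> (br (f c) (f a))"
    if "a \<in> carrier \<pi>" "b \<in> carrier \<pi>" "c \<in> carrier \<pi>" for a b c
    using that br_mult_right[of "f c" "f a" "f b"] act_br[of "f a" "f c" "f b"]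
    by (simp add: E.inv_mult_group)
  moreover have "inv\<^bsub>E\<^esub> (br (f (b \<otimes>\<^bsub>\<pi>\<^esub> c)) (f a)) =
      inv\<^bsub>E\<^esub> (br (f b) (f a)) \<otimes>\<^bsub>E\<^esub>
      inv\<^bsub>E\<^esub> (br (f (b \<otimes>\<^bsub>\<pi>\<^esub> c \<otimes>\<^bsub>\<pi>\<^esub> inv\<^bsub>\<pi>\<^esub> b)) (f (b \<otimes>\<^bsub>\<pi>\<^esub> a \<otimes>\<^bsub>\<pi>\<^esub> inv\<^bsub>\<pi>\<^esub> b)))"
    if "a \<in> carrier \<pi>" "b \<in> carrier \<pi>" "c \<in> carrier \<pi>" for a b c
    \<comment> \<open>The product b c is read as (b c inv b) b.\<close>
    using that br_mult_left[of "f b \<otimes>\<^bsub>G\<^esub> f c \<otimes>\<^bsub>G\<^esub> inv\<^bsub>G\<^esub> (f b)" "f b" "f a"]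
    by (simp add: E.inv_mult_group G.m_assoc)
  ultimately show "hat \<pi> E br f \<in> hom T E"
    and "y \<in> carrier \<pi> \<Longrightarrow> z \<in> carrier \<pi> \<Longrightarrow>
      hat \<pi> E br f (tensor \<pi> y z) = inv\<^bsub>E\<^esub> (br (f z) (f y))"
    unfolding hat_def
    using tensor_hom_hom[OF f.G.group_axioms group_E, of "\<lambda>y z. inv\<^bsub>E\<^esub> (br (f z) (f y))"]
    by simp_all
qed

sublocale hat: group_hom T E "hat \<pi> E br f"
  by unfold_locales (rule hat_hom)

lemma tensor_delta_hom: "tensor_delta \<pi> \<in> hom T \<pi>"
  and tensor_delta_tensor: "y \<in> carrier \<pi> \<Longrightarrow> z \<in> carrier \<pi> \<Longrightarrow>
    tensor_delta \<pi> (tensor \<pi> y z) = commutator \<pi> y z"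
  unfolding tensor_delta_def
  by (rule tensor_hom_hom; simp add: f.G.group_axioms commutator_def f.G.inv_mult_group f.G.m_assoc)+

sublocale tensor_delta: group_hom T \<pi> "tensor_delta \<pi>"
  by unfold_locales (rule tensor_delta_hom)

text \<open>The derived action involves the boundary map, so \<open>hat_act\<close> needs this. On
  generators the inverse in \<open>hat\<close> and the swapped arguments cancel, since the inverse
  of a commutator [a,b] is [b,a].\<close>

lemma delta_hat:
  assumes "t \<in> carrier T"
  shows "\<delta> (hat \<pi> E br f t) = f (tensor_delta \<pi> t)"
proof -
  have "(\<delta> \<circ> hat \<pi> E br f) t = (f \<circ> tensor_delta \<pi>) t"
  proof (rule T.hom_eq_on_gens[OF group_G])
    show "\<delta> \<circ> hat \<pi> E br f \<in> hom T.PG G" "f \<circ> tensor_delta \<pi> \<in> hom T.PG G" "t \<in> carrier T.PG"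
      using assms hom_compose[OF hat_hom delta_hom] hom_compose[OF tensor_delta_hom f.homh]
      by (simp_all add: tensor_square_def)
    fix s assume "s \<in> carrier \<pi> \<times> carrier \<pi>"
    then obtain y z where s: "s = (y, z)" "y \<in> carrier \<pi>" "z \<in> carrier \<pi>" by auto
    then have "\<delta> (hat \<pi> E br f (tensor \<pi> y z)) = f (tensor_delta \<pi> (tensor \<pi> y z))"
      by (simp add: hat_tensor tensor_delta_tensor delta_br commutator_def G.inv_mult_group G.m_assoc)
    then show "(\<delta> \<circ> hat \<pi> E br f) (pres_gen (carrier \<pi> \<times> carrier \<pi>) (tensor_relations \<pi>) s) =
        (f \<circ> tensor_delta \<pi>) (pres_gen (carrier \<pi> \<times> carrier \<pi>) (tensor_relations \<pi>) s)"
      by (simp add: s(1) tensor_def)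
  qed
  then show ?thesis by simp
qed

lemma tensor_braiding_closed [simp]:
  "y \<in> carrier \<pi> \<Longrightarrow> z \<in> carrier \<pi> \<Longrightarrow> tensor_braiding \<pi> y z \<in> carrier T"
  by (simp add: tensor_braiding_def)

text \<open>Both \<open>tensor_braiding\<close> and \<open>hat\<close> swap the arguments and
  invert, and the two effects cancel.\<close>

lemma hat_tensor_braiding:
  "y \<in> carrier \<pi> \<Longrightarrow> z \<in> carrier \<pi> \<Longrightarrow> hat \<pi> E br f (tensor_braiding \<pi> y z) = br (f y) (f z)"
  by (simp add: tensor_braiding_def hat_tensor)

lemma tensor_act_closed [simp]: "y \<in> carrier \<pi> \<Longrightarrow> t \<in> carrier T \<Longrightarrow> Tact y t \<in> carrier T"
  by (simp add: braided_act_def)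

lemma hat_act:
  "y \<in> carrier \<pi> \<Longrightarrow> t \<in> carrier T \<Longrightarrow> hat \<pi> E br f (Tact y t) = act (f y) (hat \<pi> E br f t)"
  by (simp add: braided_act_def hat_tensor_braiding delta_hat)

end

section \<open>Traversing a string knot diagram\<close>

text \<open>Without branching or merging, each new step of an undirected path either prolongs the
  directed path found so far or retraces its outermost edge at that end.\<close>

lemma linear_comparable:
  assumes J: "single_valued J" "single_valued (J\<inverse>)"
    and "(p, q) \<in> (J \<union> J\<inverse>)\<^sup>*"
  shows "(p, q) \<in> J\<^sup>* \<or> (q, p) \<in> J\<^sup>*"
  using assms(3)
proof (induction rule: rtrancl_induct)
  case (step q r)
  show ?case
  proof (cases "(q, r) \<in> J")
    case True
    from step.IH show ?thesis
    proof
      assume "(q, p) \<in> J\<^sup>*"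
      then show ?thesis
        using True J(1) by (cases rule: converse_rtranclE) (auto dest: single_valuedD)
    qed (use True in \<open>auto intro: rtrancl_into_rtrancl\<close>)
  next
    case False
    then have "(r, q) \<in> J"
      using step.hyps by auto
    from step.IH show ?thesis
    proof
      assume "(p, q) \<in> J\<^sup>*"
      then show ?thesis
        using \<open>(r, q) \<in> J\<close> J(2) by (cases rule: rtranclE) (auto dest: single_valuedD)
    qed (use \<open>(r, q) \<in> J\<close> in \<open>auto intro: converse_rtrancl_into_rtrancl\<close>)
  qed
qed auto

text \<open>The sequence \<open>a\<close> is constrained only where a successor exists; this fits
  \<open>nth_arc\<close>, which goes on past the last arc with values that carry no
  information.\<close>

lemma path_enumeration:
  fixes R :: "('a \<times> 'a) set"
  assumes fin: "finite A"
    and R: "single_valued R" "single_valued (R\<inverse>)" "R \<subseteq> A \<times> A"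
    and reach: "\<And>x. x \<in> A \<Longrightarrow> (t, x) \<in> R\<^sup>*"
    and t: "t \<in> A" "t \<notin> Range R"
    and a: "a 0 = t" "\<And>n x. (a n, x) \<in> R \<Longrightarrow> a (Suc n) = x"
  shows "bij_betw a {..<card A} A"
    and "(x, y) \<in> R \<Longrightarrow> \<exists>n. Suc n < card A \<and> a n = x \<and> a (Suc n) = y"
proof -
  have path: "inj_on a {..n} \<and> a ` {..n} \<subseteq> A \<and> (\<forall>k<n. (a k, a (Suc k)) \<in> R)"
    if "n < card A" for n
    using that
  proof (induction n)
    case 0
    then show ?case using a(1) t(1) by auto
  next
    case (Suc n)
    then have IH: "inj_on a {..n}" "a ` {..n} \<subseteq> A" "\<And>k. k < n \<Longrightarrow> (a k, a (Suc k)) \<in> R"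
      by auto
    \<comment> \<open>If the walk stopped here, the vertices met so far would be closed under
      \<open>R\<close> and hence be all of \<open>A\<close>, but there are too few of them.\<close>
    have "(a n, a (Suc n)) \<in> R"
    proof (rule ccontr)
      assume "(a n, a (Suc n)) \<notin> R"
      then have last: "a n \<notin> Domain R"
        using a(2) by auto
      have "x \<in> a ` {..n}" if "(t, x) \<in> R\<^sup>*" for x
        using that
      proof (induction rule: rtrancl_induct)
        case base
        then show ?case using a(1) by force
      next
        case (step x y)
        then obtain k where k: "x = a k" "k \<le> n" by auto
        then have "k < n"
          using step.hyps(2) last by (cases "k = n") auto
        then show ?case
          using a(2) step.hyps(2) k(1) by (auto intro!: image_eqI[of _ _ "Suc k"])
      qed
      then have "A \<subseteq> a ` {..n}"
        using reach by blast
      then have "card A \<le> Suc n"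
        by (metis card_atMost card_image_le card_mono finite_atMost finite_imageI le_trans)
      then show False using Suc.prems by simp
    qed
    then have steps: "\<forall>k<Suc n. (a k, a (Suc k)) \<in> R"
      using IH(3) by (auto simp: less_Suc_eq)
    \<comment> \<open>A return to \<open>t\<close> is excluded as \<open>t\<close> has no
      predecessor; a return to a later vertex would give that vertex two distinct
      predecessors.\<close>
    have "a (Suc n) \<notin> a ` {..n}"
    proof
      assume "a (Suc n) \<in> a ` {..n}"
      then obtain k where k: "k \<le> n" "a (Suc n) = a k" by auto
      show False
      proof (cases k)
        case 0
        then show False
          using steps k t(2) a(1) by (metis Range.intros lessI)
      next
        case (Suc j)
        then have "(a j, a k) \<in> R" "(a n, a k) \<in> R"
          using steps k by (auto simp flip: k(2))
        then have "a j = a n"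
          using R(2) by (auto dest: single_valuedD)
        then show False
          using IH(1) k(1) Suc by (auto dest!: inj_onD)
      qed
    qed
    then show ?case
      using steps IH(1,2) R(3) by (auto simp: atMost_Suc)
  qed
  have "card A > 0"
    using fin t(1) by (auto simp: card_gt_0_iff)
  define N where "N = card A - 1"
  have N: "{..<card A} = {..N}" "N < card A"
    using \<open>card A > 0\<close> by (auto simp: N_def)
  then have inj: "inj_on a {..<card A}" and "a ` {..<card A} \<subseteq> A"
    using path[OF N(2)] by auto
  then have image: "a ` {..<card A} = A"
    using fin by (intro card_subset_eq) (auto simp: card_image)
  show "bij_betw a {..<card A} A"
    using inj image by (simp add: bij_betw_def)
  assume xy: "(x, y) \<in> R"
  then obtain n where n: "n < card A" "a n = x"
    using R(3) image by (metis SigmaD1 image_iff lessThan_iff subsetD)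
  have y: "a (Suc n) = y"
    using a(2) xy n(2) by blast
  \<comment> \<open>A successor of the last vertex would occur earlier in the list, which again
    produces a predecessor of \<open>t\<close> or a second predecessor.\<close>
  have "n \<noteq> N"
  proof
    assume "n = N"
    obtain j where j: "j < card A" "a j = y"
      using R(3) xy image by (metis SigmaD2 image_iff lessThan_iff subsetD)
    show False
    proof (cases j)
      case 0
      then show False
        using j xy a(1) t(2) by auto
    next
      case (Suc i)
      then have "(a i, y) \<in> R"
        using path[OF j(1)] j(2) by auto
      then have "a i = a n"
        using R(2) xy n(2) by (auto dest: single_valuedD)
      then have "i = n"
        using inj j(1) n(1) Suc by (auto dest: inj_onD)
      then show False
        using \<open>n = N\<close> Suc j(1) by (simp add: N_def)
    qed
  qed
  then show "\<exists>n. Suc n < card A \<and> a n = x \<and> a (Suc n) = y"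
    using n y by (intro exI[of _ n]) (auto simp: N_def)
qed

lemma symmetric_closure_equiv:
  "(p, q) \<in> (J \<union> J\<inverse>)\<^sup>* \<Longrightarrow> (q, p) \<in> (J \<union> J\<inverse>)\<^sup>*"
  by (metis converse_Un converse_converse rtrancl_converseI sup_commute)

lemma arc_of_eq_iff: "arc_of D p = arc_of D q \<longleftrightarrow> (p, q) \<in> (joins D \<union> (joins D)\<inverse>)\<^sup>*"
  unfolding arc_of_def
  using symmetric_closure_equiv[of _ _ "joins D"] by (blast intro: rtrancl_trans)

section \<open>Orienting the strands strip by strip\<close>

text \<open>The points through which the oriented strands enter strip \<open>i\<close>, from above or from below,
  and those through which they leave it.\<close>

definition flow_in :: "diagram \<Rightarrow> nat \<Rightarrow> point set" where
  "flow_in D i = {(h, j). h = i \<and> level D h ! j = Down \<or> h = Suc i \<and> level D h ! j = Up}"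

definition flow_out :: "diagram \<Rightarrow> nat \<Rightarrow> point set" where
  "flow_out D i = {(h, j). h = i \<and> level D h ! j = Up \<or> h = Suc i \<and> level D h ! j = Down}"

text \<open>The orientation at a point decides which of the two strips that may meet there is
  entered and which is left.\<close>

lemma flow_in_unique: "p \<in> flow_in D i \<Longrightarrow> p \<in> flow_in D j \<Longrightarrow> i = j"
  and flow_out_unique: "p \<in> flow_out D i \<Longrightarrow> p \<in> flow_out D j \<Longrightarrow> i = j"
  by (auto simp: flow_in_def flow_out_def)

definition under_point_top :: "diagram \<Rightarrow> nat \<Rightarrow> point" where
  "under_point_top D i = (i, length (left_at D i) + (if piece_at D i = XPos then 0 else 1))"

definition under_point_bot :: "diagram \<Rightarrow> nat \<Rightarrow> point" where
  "under_point_bot D i = (Suc i, length (left_at D i) + (if piece_at D i = XPos then 1 else 0))"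

lemma under_top_eq: "under_top D i = arc_of D (under_point_top D i)"
  and under_bot_eq: "under_bot D i = arc_of D (under_point_bot D i)"
  by (simp_all add: under_top_def under_bot_def under_point_top_def under_point_bot_def Let_def)

lemma under_joins_eq:
  "under_joins D = (\<lambda>i. (under_point_top D i, under_point_bot D i)) ` crossings D"
  by (auto simp: under_joins_def under_joins_at_def crossings_def under_point_top_def
      under_point_bot_def Let_def split: piece.splits)

text \<open>Pairs in \<open>joins_at\<close> run from top to bottom, or from left to right at cups
  and caps, whatever the direction of the strand; here they are turned along it.\<close>

definition over_steps_at :: "diagram \<Rightarrow> nat \<Rightarrow> (point \<times> point) set" where
  "over_steps_at D i = (joins_at D i \<union> (joins_at D i)\<inverse>) \<inter> flow_in D i \<times> flow_out D i"

definition over_steps :: "diagram \<Rightarrow> (point \<times> point) set" where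
  "over_steps D = (\<Union>i<length D. over_steps_at D i)"

definition arc_steps :: "diagram \<Rightarrow> (arc \<times> arc) set" where
  "arc_steps D = (\<lambda>i. (under_top D i, under_bot D i)) ` crossings D"

locale string_knot =
  fixes D :: diagram
  assumes string_knot: "string_knot_diagram D"
begin

lemma level_top:
  assumes "i < length D"
  shows "level D i = left_at D i @ piece_top (piece_at D i) @ right_at D i"
proof -
  have "level D i = strip_top (D ! i)"
    using string_knot assms by (simp add: string_knot_diagram_def)
  then show ?thesis
    by (cases "D ! i") (simp add: left_at_def piece_at_def right_at_def)
qed

lemma level_bot:
  "level D (Suc i) = left_at D i @ piece_bot (piece_at D i) @ right_at D i"
  by (cases "D ! i") (simp add: left_at_def piece_at_def right_at_def)

lemma joins_at_directed:
  assumes i: "i < length D" and pq: "(p, q) \<in> joins_at D i"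
  shows "(p, q) \<in> over_steps_at D i \<or> (q, p) \<in> over_steps_at D i"
proof -
  define k where "k = length (left_at D i)"
  define a where "a = k + length (piece_top (piece_at D i))"
  define b where "b = k + length (piece_bot (piece_at D i))"
  note levels = level_top[OF i] level_bot[of i]
  \<comment> \<open>Vertical lines and over strands keep their orientation across the strip; cups
    and caps, whose two ends lie on one level with opposite orientations, are treated
    separately.\<close>
  have same: ?thesis if "p = (i, j)" "q = (Suc i, j')" "level D i ! j = level D (Suc i) ! j'" for j j'
    using that pq by (cases "level D i ! j") (auto simp: over_steps_at_def flow_in_def flow_out_def)
  consider (left) j where "p = (i, j)" "q = (Suc i, j)" "j < k"
    | (right) j where "p = (i, a + j)" "q = (Suc i, b + j)" "j < length (right_at D i)"
    | (cap) d where "piece_at D i = Cap d" "p = (Suc i, k)" "q = (Suc i, Suc k)"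
    | (cup) d where "piece_at D i = Cup d" "p = (i, k)" "q = (i, Suc k)"
    | (pos) "piece_at D i = XPos" "p = (i, Suc k)" "q = (Suc i, k)"
    | (neg) "piece_at D i = XNeg" "p = (i, k)" "q = (Suc i, Suc k)"
    using pq unfolding joins_at_def Let_def k_def[symmetric] a_def[symmetric] b_def[symmetric]
    by (auto split: piece.splits)
  then show ?thesis
  proof cases
    case left
    then show ?thesis
      by (intro same[OF left(1,2)]) (auto simp: levels nth_append k_def simp del: level.simps)
  next
    case right
    then show ?thesis
      by (intro same[OF right(1,2)]) (auto simp: levels nth_append a_def b_def k_def simp del: level.simps)
  next
    case cap
    then have "level D (Suc i) ! k = d" "level D (Suc i) ! Suc k = opposite d"
      by (simp_all add: levels nth_append k_def del: level.simps)
    then show ?thesis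
      using cap pq by (cases d) (auto simp: over_steps_at_def flow_in_def flow_out_def simp del: level.simps)
  next
    case cup
    then have "level D i ! k = d" "level D i ! Suc k = opposite d"
      by (simp_all add: levels nth_append k_def del: level.simps)
    then show ?thesis
      using cup pq by (cases d) (auto simp: over_steps_at_def flow_in_def flow_out_def simp del: level.simps)
  next
    case pos
    then show ?thesis
      by (intro same[OF pos(2,3)]) (auto simp: levels nth_append k_def simp del: level.simps)
  next
    case neg
    then show ?thesis
      by (intro same[OF neg(2,3)]) (auto simp: levels nth_append k_def simp del: level.simps)
  qed
qed

lemma joins_at_unique:
  assumes "(p, q) \<in> joins_at D i \<union> (joins_at D i)\<inverse>" "(p, q') \<in> joins_at D i \<union> (joins_at D i)\<inverse>"
  shows "q = q'"
  using assms unfolding joins_at_def Let_def by (cases "piece_at D i") auto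

lemma under_point_directed:
  assumes "i \<in> crossings D"
  shows "under_point_top D i \<in> flow_in D i" "under_point_bot D i \<in> flow_out D i"
  using assms
  by (auto simp: crossings_def under_point_top_def under_point_bot_def flow_in_def flow_out_def
      level_top level_bot nth_append simp del: level.simps)

lemma under_point_not_joined:
  assumes "i \<in> crossings D"
  shows "under_point_top D i \<notin> Field (joins_at D i)" "under_point_bot D i \<notin> Field (joins_at D i)"
  using assms
  by (auto simp: crossings_def under_point_top_def under_point_bot_def joins_at_def Let_def Field_def)

text \<open>The orientation singles out the strip in which a step from (or to) a point takes place,
  and in one strip a point has at most one partner.\<close>

lemma single_valued_over_steps: "single_valued (over_steps D)" "single_valued ((over_steps D)\<inverse>)"
proof -
  show "single_valued (over_steps D)"
  proof (rule single_valuedI)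
    fix p q q' assume "(p, q) \<in> over_steps D" "(p, q') \<in> over_steps D"
    then show "q = q'"
      unfolding over_steps_def over_steps_at_def
      by clarify (metis flow_in_unique joins_at_unique)
  qed
  show "single_valued ((over_steps D)\<inverse>)"
  proof (rule single_valuedI)
    fix p q q' assume "(p, q) \<in> (over_steps D)\<inverse>" "(p, q') \<in> (over_steps D)\<inverse>"
    then show "q = q'"
      unfolding over_steps_def over_steps_at_def converse_iff
      by clarify (metis (no_types, lifting) Un_iff converse_iff flow_out_unique joins_at_unique)
  qed
qed

lemma joins_over_steps: "joins D \<union> (joins D)\<inverse> = over_steps D \<union> (over_steps D)\<inverse>"
  using joins_at_directed by (fastforce simp: joins_def over_steps_def over_steps_at_def)

lemma arc_of_eq_cases:
  assumes "arc_of D p = arc_of D q"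
  shows "(p, q) \<in> (over_steps D)\<^sup>* \<or> (q, p) \<in> (over_steps D)\<^sup>*"
  using assms by (simp add: arc_of_eq_iff joins_over_steps linear_comparable single_valued_over_steps)

text \<open>An arc stops where it passes under: the only strip entered from this point is the
  crossing itself, which does not join the point to anything.\<close>

lemma under_point_top_not_Domain:
  assumes "i \<in> crossings D"
  shows "under_point_top D i \<notin> Domain (over_steps D)"
proof
  assume "under_point_top D i \<in> Domain (over_steps D)"
  then obtain j where j: "under_point_top D i \<in> flow_in D j" "under_point_top D i \<in> Field (joins_at D j)"
    by (auto simp: over_steps_def over_steps_at_def Field_def)
  then have "j = i"
    using under_point_directed(1)[OF assms] by (simp add: flow_in_unique)
  then show False
    using j(2) under_point_not_joined(1)[OF assms] by simp
qed

lemma under_point_bot_not_Range: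
  assumes "i \<in> crossings D"
  shows "under_point_bot D i \<notin> Range (over_steps D)"
proof
  assume "under_point_bot D i \<in> Range (over_steps D)"
  then obtain j where j: "under_point_bot D i \<in> flow_out D j" "under_point_bot D i \<in> Field (joins_at D j)"
    by (auto simp: over_steps_def over_steps_at_def Field_def)
  then have "j = i"
    using under_point_directed(2)[OF assms] by (simp add: flow_out_unique)
  then show False
    using j(2) under_point_not_joined(2)[OF assms] by simp
qed

lemma top_not_flow_out: "(0, 0) \<notin> flow_out D i"
  by (simp add: flow_out_def)

text \<open>Two points of one arc are linked by a directed path, but no step leaves either of these
  two, so they coincide. This makes \<open>exit_crossing\<close> well determined.\<close>

lemma under_top_inj:
  assumes "i \<in> crossings D" "j \<in> crossings D" "under_top D i = under_top D j"
  shows "i = j"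
proof -
  have "under_point_top D i = under_point_top D j"
    using arc_of_eq_cases[OF assms(3)[unfolded under_top_eq]]
      under_point_top_not_Domain[OF assms(1)] under_point_top_not_Domain[OF assms(2)]
    by (metis Not_Domain_rtrancl)
  then show ?thesis
    by (simp add: under_point_top_def)
qed

lemma under_bot_inj:
  assumes "i \<in> crossings D" "j \<in> crossings D" "under_bot D i = under_bot D j"
  shows "i = j"
proof -
  have "under_point_bot D i = under_point_bot D j"
    using arc_of_eq_cases[OF assms(3)[unfolded under_bot_eq]]
      under_point_bot_not_Range[OF assms(1)] under_point_bot_not_Range[OF assms(2)]
    by (metis Range.intros rtranclE)
  then show ?thesis
    by (simp add: under_point_bot_def)
qed

lemma under_bot_neq_top:
  assumes "i \<in> crossings D"
  shows "under_bot D i \<noteq> top_arc D"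
proof
  assume "under_bot D i = top_arc D"
  moreover have "(0, 0) \<notin> Range (over_steps D)"
    using top_not_flow_out by (auto simp: over_steps_def over_steps_at_def)
  ultimately have "under_point_bot D i = (0, 0)"
    using arc_of_eq_cases[of "under_point_bot D i" "(0, 0)"] under_point_bot_not_Range[OF assms]
    by (metis Range.intros rtranclE top_arc_def under_bot_eq)
  then show False
    by (simp add: under_point_bot_def)
qed

section \<open>The order of the arcs along the string\<close>

lemma single_valued_arc_steps: "single_valued (arc_steps D)" "single_valued ((arc_steps D)\<inverse>)"
  by (auto simp: arc_steps_def single_valued_def dest: under_top_inj under_bot_inj)

lemma top_not_Range_arc_steps: "top_arc D \<notin> Range (arc_steps D)"
  using under_bot_neq_top by (force simp: arc_steps_def)

lemma top_in_points: "(0, 0) \<in> points D"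
  by (simp add: points_def)

lemma arc_reachable:
  assumes "a \<in> arcs D"
  shows "(top_arc D, a) \<in> (arc_steps D)\<^sup>*"
proof -
  obtain p where p: "p \<in> points D" "a = arc_of D p"
    using assms by (auto simp: arcs_def)
  have "((0, 0), p) \<in> (joins D \<union> under_joins D \<union> (joins D \<union> under_joins D)\<inverse>)\<^sup>*"
    using string_knot p(1) top_in_points by (simp add: string_knot_diagram_def)
  then have "(top_arc D, arc_of D p) \<in> (arc_steps D)\<^sup>*"
  proof (induction rule: rtrancl_induct)
    case (step p q)
    then consider "(p, q) \<in> joins D \<union> (joins D)\<inverse>" | "(p, q) \<in> under_joins D" | "(q, p) \<in> under_joins D"
      by auto
    then show ?case
    proof cases
      case 1
      then have "arc_of D p = arc_of D q"
        unfolding arc_of_eq_iff by (rule r_into_rtrancl)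
      then show ?thesis using step.IH by simp
    next
      case 2
      then have "(arc_of D p, arc_of D q) \<in> arc_steps D"
        by (auto simp: under_joins_eq arc_steps_def under_top_eq under_bot_eq)
      then show ?thesis using step.IH by simp
    next
      \<comment> \<open>A crossing traversed backwards: the directed path to the current arc is not
        empty, because no step enters the top arc, and as steps do not merge its last step is this
        crossing; dropping it leaves a path to the new arc.\<close>
      case 3
      then have q: "(arc_of D q, arc_of D p) \<in> arc_steps D"
        by (auto simp: under_joins_eq arc_steps_def under_top_eq under_bot_eq)
      from step.IH show ?thesis
      proof (cases rule: rtranclE)
        case base
        then show ?thesis
          using q top_not_Range_arc_steps by auto
      next
        case (step b)
        then show ?thesis
          using q single_valued_arc_steps(2) by (auto dest: single_valuedD)
      qed
    qed
  qed (simp add: top_arc_def)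
  then show ?thesis by (simp add: p(2))
qed

lemma top_arc_in_arcs [simp]: "top_arc D \<in> arcs D"
  using top_in_points by (simp add: arcs_def top_arc_def)

lemma bottom_arc_in_arcs [simp]: "bottom_arc D \<in> arcs D"
  using string_knot by (auto simp: arcs_def bottom_arc_def points_def string_knot_diagram_def)

lemma crossing_arcs [simp]:
  assumes "i \<in> crossings D"
  shows "over_arc D i \<in> arcs D" "under_top D i \<in> arcs D" "under_bot D i \<in> arcs D"
  using assms
  by (auto simp: crossings_def over_arc_def under_top_def under_bot_def arcs_def points_def Let_def
      level_top level_bot simp del: level.simps)

lemma finite_arcs: "finite (arcs D)"
proof -
  have "points D = (SIGMA i:{..length D}. {..<length (level D i)})"
    by (auto simp: points_def)
  then show ?thesis by (simp add: arcs_def)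
qed

lemma exit_crossing_under_top: "i \<in> crossings D \<Longrightarrow> exit_crossing D (under_top D i) = i"
  unfolding exit_crossing_def by (rule the_equality) (auto dest: under_top_inj)

lemma arc_enumeration:
  "bij_betw (nth_arc D) {..<card (arcs D)} (arcs D)"
  "i \<in> crossings D \<Longrightarrow> \<exists>n. Suc n < card (arcs D) \<and> nth_arc D n = under_top D i \<and>
     nth_arc D (Suc n) = under_bot D i"
proof -
  have "arc_steps D \<subseteq> arcs D \<times> arcs D"
    by (auto simp: arc_steps_def)
  moreover have "nth_arc D (Suc n) = x" if "(nth_arc D n, x) \<in> arc_steps D" for n x
    using that by (auto simp: arc_steps_def exit_crossing_under_top)
  ultimately show "bij_betw (nth_arc D) {..<card (arcs D)} (arcs D)"
    and "i \<in> crossings D \<Longrightarrow> \<exists>n. Suc n < card (arcs D) \<and> nth_arc D n = under_top D i \<and>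
      nth_arc D (Suc n) = under_bot D i"
    using path_enumeration[OF finite_arcs single_valued_arc_steps, of "top_arc D" "nth_arc D"]
      arc_reachable top_not_Range_arc_steps
    by (simp_all add: arc_steps_def del: nth_arc.simps(2))
qed

text \<open>Carries a property along the string without indices; the numbering of the arcs serves to
  compute \<open>arc_longitude\<close> at the top and across a crossing.\<close>

lemma arc_induct [consumes 1, case_names top under]:
  assumes "a \<in> arcs D"
    and "P (top_arc D)"
    and "\<And>i. i \<in> crossings D \<Longrightarrow> P (under_top D i) \<Longrightarrow> P (under_bot D i)"
  shows "P a"
  using arc_reachable[OF assms(1)]
  by (induction rule: rtrancl_induct) (use assms(2,3) in \<open>auto simp: arc_steps_def\<close>)

section \<open>Partial longitudes as labels of arcs\<close>

lemma arc_longitude_nth_arc: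
  assumes "n < card (arcs D)"
  shows "arc_longitude D \<pi> g (nth_arc D n) = partial_longitude D \<pi> g n"
proof -
  have "(THE n'. n' < card (arcs D) \<and> nth_arc D n' = nth_arc D n) = n"
    using assms arc_enumeration(1) by (intro the_equality) (auto simp: bij_betw_def dest: inj_onD)
  then show ?thesis by (simp add: arc_longitude_def)
qed

lemma arc_longitude_top: "arc_longitude D \<pi> g (top_arc D) = \<one>\<^bsub>\<pi>\<^esub>"
proof -
  have "card (arcs D) > 0"
    using finite_arcs top_arc_in_arcs by (metis card_gt_0_iff empty_iff)
  then show ?thesis
    using arc_longitude_nth_arc[of 0 \<pi> g] by simp
qed

lemma arc_longitude_under_bot:
  assumes "i \<in> crossings D"
  shows "arc_longitude D \<pi> g (under_bot D i) =
    arc_longitude D \<pi> g (under_top D i)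
      \<otimes>\<^bsub>\<pi>\<^esub> g (under_top D i) [^]\<^bsub>\<pi>\<^esub> (- crossing_sign D i)
      \<otimes>\<^bsub>\<pi>\<^esub> g (over_arc D i) [^]\<^bsub>\<pi>\<^esub> crossing_sign D i"
proof -
  obtain n where n: "Suc n < card (arcs D)" "nth_arc D n = under_top D i"
      "nth_arc D (Suc n) = under_bot D i"
    using arc_enumeration(2)[OF assms] by blast
  have "arc_longitude D \<pi> g (under_bot D i) = partial_longitude D \<pi> g (Suc n)"
    using arc_longitude_nth_arc[OF n(1)] n(3) by metis
  also have "\<dots> = partial_longitude D \<pi> g n
      \<otimes>\<^bsub>\<pi>\<^esub> g (under_top D i) [^]\<^bsub>\<pi>\<^esub> (- crossing_sign D i)
      \<otimes>\<^bsub>\<pi>\<^esub> g (over_arc D i) [^]\<^bsub>\<pi>\<^esub> crossing_sign D i"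
    by (simp add: Let_def n(2) exit_crossing_under_top[OF assms])
  also have "partial_longitude D \<pi> g n = arc_longitude D \<pi> g (under_top D i)"
    using arc_longitude_nth_arc[of n \<pi> g] n(1) by (simp add: n(2))
  finally show ?thesis .
qed

end

section \<open>Colourings with top label \<open>1\<close> and morphisms out of the knot group\<close>

context braided
begin

lemma phi_pair_closed [simp]:
  "x \<in> carrier G \<Longrightarrow> X \<in> carrier G \<Longrightarrow> Y \<in> carrier G \<Longrightarrow> phi_pair G br x X Y \<in> carrier E"
  by (simp add: phi_pair_def)

lemma psi_pair_closed [simp]:
  "x \<in> carrier G \<Longrightarrow> X \<in> carrier G \<Longrightarrow> Y \<in> carrier G \<Longrightarrow> psi_pair E G br x X Y \<in> carrier E"
  by (simp add: psi_pair_def)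

text \<open>The colouring rule prescribes the incoming under arc \<open>Z\<close>. Solved for the
  outgoing \<open>Y\<close>, it propagates labels along the orientation, in the form met again in
  \<open>lon_under_bot_meridian\<close>.\<close>

lemma psi_pair_crossing_iff:
  assumes "x \<in> carrier G" "X \<in> carrier G" "Y \<in> carrier G" "Z \<in> carrier G"
  shows "Z = inv\<^bsub>G\<^esub> (\<delta> (psi_pair E G br x X Y)) \<otimes>\<^bsub>G\<^esub> X \<otimes>\<^bsub>G\<^esub> Y \<otimes>\<^bsub>G\<^esub> inv\<^bsub>G\<^esub> X \<longleftrightarrow>
    Y = inv\<^bsub>G\<^esub> x \<otimes>\<^bsub>G\<^esub> Z \<otimes>\<^bsub>G\<^esub> inv\<^bsub>G\<^esub> X \<otimes>\<^bsub>G\<^esub> x \<otimes>\<^bsub>G\<^esub> X"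
proof -
  have "inv\<^bsub>G\<^esub> (\<delta> (psi_pair E G br x X Y)) \<otimes>\<^bsub>G\<^esub> X \<otimes>\<^bsub>G\<^esub> Y \<otimes>\<^bsub>G\<^esub> inv\<^bsub>G\<^esub> X =
      x \<otimes>\<^bsub>G\<^esub> Y \<otimes>\<^bsub>G\<^esub> inv\<^bsub>G\<^esub> X \<otimes>\<^bsub>G\<^esub> inv\<^bsub>G\<^esub> x \<otimes>\<^bsub>G\<^esub> X"
    using assms by (simp add: psi_pair_def delta_br commutator_def G.inv_mult_group G.m_assoc)
  then show ?thesis
    using assms by (auto simp: G.m_assoc)
qed

lemma phi_pair_crossing_iff:
  assumes "x \<in> carrier G" "X \<in> carrier G" "Y \<in> carrier G" "Z \<in> carrier G"
  shows "Z = inv\<^bsub>G\<^esub> X \<otimes>\<^bsub>G\<^esub> inv\<^bsub>G\<^esub> (\<delta> (phi_pair G br x X Y)) \<otimes>\<^bsub>G\<^esub> Y \<otimes>\<^bsub>G\<^esub> X \<longleftrightarrow>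
    Y = x \<otimes>\<^bsub>G\<^esub> Z \<otimes>\<^bsub>G\<^esub> inv\<^bsub>G\<^esub> X \<otimes>\<^bsub>G\<^esub> inv\<^bsub>G\<^esub> x \<otimes>\<^bsub>G\<^esub> X"
proof -
  have "inv\<^bsub>G\<^esub> X \<otimes>\<^bsub>G\<^esub> inv\<^bsub>G\<^esub> (\<delta> (phi_pair G br x X Y)) \<otimes>\<^bsub>G\<^esub> Y \<otimes>\<^bsub>G\<^esub> X =
      inv\<^bsub>G\<^esub> x \<otimes>\<^bsub>G\<^esub> Y \<otimes>\<^bsub>G\<^esub> inv\<^bsub>G\<^esub> X \<otimes>\<^bsub>G\<^esub> x \<otimes>\<^bsub>G\<^esub> X"
    using assms by (simp add: phi_pair_def delta_br commutator_def G.inv_mult_group G.m_assoc)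
  then show ?thesis
    using assms by (auto simp: G.m_assoc)
qed

end

locale coloured_knot = braided E G \<delta> br + string_knot D +
  presented_by "arcs D" "wirtinger_relations D" \<pi> g
  for E :: "('e, 'k) monoid_scheme" and G :: "('h, 'n) monoid_scheme"
    and \<delta> :: "'e \<Rightarrow> 'h" and br :: "'h \<Rightarrow> 'h \<Rightarrow> 'e" and D
    and \<pi> :: "('p, 'q) monoid_scheme" and g :: "arc \<Rightarrow> 'p" +
  fixes x :: 'h
  assumes x [simp]: "x \<in> carrier G" and finite_G: "finite (carrier G)"
begin

sublocale \<pi>: group \<pi> by (rule is_group)

lemma g_closed [simp]: "a \<in> arcs D \<Longrightarrow> g a \<in> carrier \<pi>"
  using gens_in_carrier by auto

text \<open>Reidemeister colourings with top label 1 and free bottom label, stripped of the crossing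
  labels, which the arcs determine, and with the crossing equations solved for the outgoing under
  arc.\<close>

definition arc_colourings :: "(arc \<Rightarrow> 'h) set" where
  "arc_colourings = {c. c \<in> arcs D \<rightarrow>\<^sub>E carrier G \<and> c (top_arc D) = \<one>\<^bsub>G\<^esub> \<and>
     (\<forall>i\<in>crossings D. let X = c (over_arc D i); Y = c (under_bot D i); Z = c (under_top D i) in
       Y = (if piece_at D i = XPos then inv\<^bsub>G\<^esub> x \<otimes>\<^bsub>G\<^esub> Z \<otimes>\<^bsub>G\<^esub> inv\<^bsub>G\<^esub> X \<otimes>\<^bsub>G\<^esub> x \<otimes>\<^bsub>G\<^esub> X
            else x \<otimes>\<^bsub>G\<^esub> Z \<otimes>\<^bsub>G\<^esub> inv\<^bsub>G\<^esub> X \<otimes>\<^bsub>G\<^esub> inv\<^bsub>G\<^esub> x \<otimes>\<^bsub>G\<^esub> X))}"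

definition crossing_colours :: "(arc \<Rightarrow> 'h) \<Rightarrow> nat \<Rightarrow> 'e" where
  "crossing_colours c = (\<lambda>i\<in>crossings D.
     if piece_at D i = XPos then psi_pair E G br x (c (over_arc D i)) (c (under_bot D i))
     else phi_pair G br x (c (over_arc D i)) (c (under_bot D i)))"

lemma finite_arc_colourings: "finite arc_colourings"
  by (rule finite_subset[OF _ finite_PiE[OF finite_arcs finite_G]]) (auto simp: arc_colourings_def)

lemma reidemeister_colourings_eq:
  "reidemeister_colourings E G \<delta> (psi_pair E G br x) (phi_pair G br x) D \<one>\<^bsub>G\<^esub> b =
    (\<lambda>c. (c, crossing_colours c)) ` {c \<in> arc_colourings. c (bottom_arc D) = b}"
    (is "?L = ?R")
proof -
  have "(c, t) \<in> ?L \<longleftrightarrow> c \<in> arc_colourings \<and> c (bottom_arc D) = b \<and> t = crossing_colours c"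
    for c t
  proof (cases "c \<in> arcs D \<rightarrow>\<^sub>E carrier G")
    case True
    then have c [simp]: "c a \<in> carrier G" if "a \<in> arcs D" for a
      using that by auto
    have t: "t \<in> crossings D \<rightarrow>\<^sub>E carrier E \<and>
        (\<forall>i\<in>crossings D. t i = (if piece_at D i = XPos
          then psi_pair E G br x (c (over_arc D i)) (c (under_bot D i))
          else phi_pair G br x (c (over_arc D i)) (c (under_bot D i)))) \<longleftrightarrow>
      t = crossing_colours c"
      (is "?A \<longleftrightarrow> _")
    proof
      show "t = crossing_colours c" if ?A
        using that by (auto simp: crossing_colours_def fun_eq_iff PiE_iff extensional_def)
    qed (auto simp: crossing_colours_def)
    show ?thesis
      unfolding t[symmetric] reidemeister_colourings_def arc_colourings_def
      using True by (auto simp: Let_def psi_pair_crossing_iff phi_pair_crossing_iff split: if_splits)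
  qed (auto simp: reidemeister_colourings_def arc_colourings_def)
  then show ?thesis
    by auto
qed

text \<open>The bottom labels partition the colourings, so summing over them removes the condition
  at the bottom.\<close>

lemma sum_state_sum:
  "(\<Sum>b\<in>carrier G. state_sum E G \<delta> act (psi_pair E G br x) (phi_pair G br x) D \<one>\<^bsub>G\<^esub> b) =
   (\<Sum>c\<in>arc_colourings. frag_of (mor_elem (evaluation E G act D (c, crossing_colours c))))"
proof -
  have "state_sum E G \<delta> act (psi_pair E G br x) (phi_pair G br x) D \<one>\<^bsub>G\<^esub> b =
      (\<Sum>c | c \<in> arc_colourings \<and> c (bottom_arc D) = b.
        frag_of (mor_elem (evaluation E G act D (c, crossing_colours c))))" for b
    unfolding state_sum_def reidemeister_colourings_eq
    by (subst sum.reindex) (auto simp: inj_on_def)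
  moreover have "(\<lambda>c. c (bottom_arc D)) ` arc_colourings \<subseteq> carrier G"
    by (auto simp: arc_colourings_def)
  ultimately show ?thesis
    by (simp add: sum.group[OF finite_arc_colourings finite_G])
qed

section \<open>Partial longitudes in the knot group\<close>

lemma wirtinger_relation:
  assumes "i \<in> crossings D"
  shows "piece_at D i = XPos \<Longrightarrow>
      g (under_bot D i) = inv\<^bsub>\<pi>\<^esub> (g (over_arc D i)) \<otimes>\<^bsub>\<pi>\<^esub> g (under_top D i) \<otimes>\<^bsub>\<pi>\<^esub> g (over_arc D i)"
    and "piece_at D i \<noteq> XPos \<Longrightarrow>
      g (under_bot D i) = g (over_arc D i) \<otimes>\<^bsub>\<pi>\<^esub> g (under_top D i) \<otimes>\<^bsub>\<pi>\<^esub> inv\<^bsub>\<pi>\<^esub> (g (over_arc D i))"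
proof -
  let ?X = "over_arc D i" and ?Y = "under_bot D i" and ?Z = "under_top D i"
  show "g ?Y = inv\<^bsub>\<pi>\<^esub> (g ?X) \<otimes>\<^bsub>\<pi>\<^esub> g ?Z \<otimes>\<^bsub>\<pi>\<^esub> g ?X" if "piece_at D i = XPos"
  proof -
    have "([(?Z, True), (?X, True)], [(?X, True), (?Y, True)]) \<in> wirtinger_relations D"
      using assms that by (force simp: wirtinger_relations_def Let_def)
    then have "g ?Z \<otimes>\<^bsub>\<pi>\<^esub> g ?X = g ?X \<otimes>\<^bsub>\<pi>\<^esub> g ?Y"
      using assms by (auto dest: word_value_rel)
    then show ?thesis
      using assms by (simp add: \<pi>.m_assoc)
  qed
  show "g ?Y = g ?X \<otimes>\<^bsub>\<pi>\<^esub> g ?Z \<otimes>\<^bsub>\<pi>\<^esub> inv\<^bsub>\<pi>\<^esub> (g ?X)" if "piece_at D i \<noteq> XPos"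
  proof -
    have "([(?X, True), (?Z, True)], [(?Y, True), (?X, True)]) \<in> wirtinger_relations D"
      using assms that by (force simp: wirtinger_relations_def Let_def)
    then have "g ?X \<otimes>\<^bsub>\<pi>\<^esub> g ?Z = g ?Y \<otimes>\<^bsub>\<pi>\<^esub> g ?X"
      using assms by (auto dest: word_value_rel)
    then show ?thesis
      using assms by (simp add: \<pi>.m_assoc)
  qed
qed

abbreviation "lon \<equiv> arc_longitude D \<pi> g"
abbreviation "m \<equiv> meridian D g"

lemma meridian_closed [simp]: "m \<in> carrier \<pi>"
  by (simp add: meridian_def)

lemma lon_under_bot:
  assumes "i \<in> crossings D"
  shows "lon (under_bot D i) =
    (if piece_at D i = XPos
     then lon (under_top D i) \<otimes>\<^bsub>\<pi>\<^esub> inv\<^bsub>\<pi>\<^esub> (g (under_top D i)) \<otimes>\<^bsub>\<pi>\<^esub> g (over_arc D i)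
     else lon (under_top D i) \<otimes>\<^bsub>\<pi>\<^esub> g (under_top D i) \<otimes>\<^bsub>\<pi>\<^esub> inv\<^bsub>\<pi>\<^esub> (g (over_arc D i)))"
  using assms
  by (simp add: arc_longitude_under_bot crossing_sign_def \<pi>.int_pow_neg \<pi>.int_pow_1)

lemma lon_closed [simp]: "a \<in> arcs D \<Longrightarrow> lon a \<in> carrier \<pi>"
  by (induction rule: arc_induct) (auto simp: arc_longitude_top lon_under_bot)

text \<open>At a crossing the longitude gains two factors on the right: a power of the incoming
  generator, which commutes with that generator, and a power of the over generator, conjugation by
  which is the Wirtinger relation.\<close>

lemma g_eq_conj_meridian:
  assumes "a \<in> arcs D"
  shows "g a = inv\<^bsub>\<pi>\<^esub> (lon a) \<otimes>\<^bsub>\<pi>\<^esub> m \<otimes>\<^bsub>\<pi>\<^esub> lon a"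
  using assms
proof (induction rule: arc_induct)
  case top
  then show ?case by (simp add: arc_longitude_top meridian_def)
next
  case (under i)
  have m: "m = lon (under_top D i) \<otimes>\<^bsub>\<pi>\<^esub> g (under_top D i) \<otimes>\<^bsub>\<pi>\<^esub> inv\<^bsub>\<pi>\<^esub> (lon (under_top D i))"
    by (subst under.IH) (use under.hyps in \<open>simp add: \<pi>.m_assoc\<close>)
  show ?case
    unfolding m using under.hyps
    by (simp add: lon_under_bot wirtinger_relation \<pi>.m_assoc \<pi>.inv_mult_group)
qed

text \<open>With the generators eliminated, the longitudes obey the recursion of
  \<open>arc_colourings\<close> with \<open>m\<close> for \<open>x\<close>, so their image under a
  morphism sending \<open>m\<close> to \<open>x\<close> is a colouring.\<close>

lemma lon_under_bot_meridian:
  assumes "i \<in> crossings D"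
  shows "lon (under_bot D i) =
    (if piece_at D i = XPos
     then inv\<^bsub>\<pi>\<^esub> m \<otimes>\<^bsub>\<pi>\<^esub> lon (under_top D i) \<otimes>\<^bsub>\<pi>\<^esub> inv\<^bsub>\<pi>\<^esub> (lon (over_arc D i)) \<otimes>\<^bsub>\<pi>\<^esub> m \<otimes>\<^bsub>\<pi>\<^esub> lon (over_arc D i)
     else m \<otimes>\<^bsub>\<pi>\<^esub> lon (under_top D i) \<otimes>\<^bsub>\<pi>\<^esub> inv\<^bsub>\<pi>\<^esub> (lon (over_arc D i)) \<otimes>\<^bsub>\<pi>\<^esub> inv\<^bsub>\<pi>\<^esub> m \<otimes>\<^bsub>\<pi>\<^esub> lon (over_arc D i))"
  using assms by (simp add: lon_under_bot g_eq_conj_meridian \<pi>.m_assoc \<pi>.inv_mult_group)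

section \<open>Morphisms sending the meridian to the given element\<close>

definition meridian_homs :: "('p \<Rightarrow> 'h) set" where
  "meridian_homs = {f. f \<in> hom \<pi> G \<inter> extensional (carrier \<pi>) \<and> f m = x}"

definition hom_colouring :: "('p \<Rightarrow> 'h) \<Rightarrow> arc \<Rightarrow> 'h" where
  "hom_colouring f = (\<lambda>a\<in>arcs D. f (lon a))"

lemma hom_colouring_in_arc_colourings:
  assumes "f \<in> meridian_homs"
  shows "hom_colouring f \<in> arc_colourings"
proof -
  interpret f: group_hom \<pi> G f
    using assms by unfold_locales (simp add: meridian_homs_def)
  have "f m = x"
    using assms by (simp add: meridian_homs_def)
  then show ?thesis
    by (auto simp: hom_colouring_def arc_colourings_def arc_longitude_top lon_under_bot_meridian Let_def)
qed

text \<open>The values on the longitudes determine those on the generators, hence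
  \<open>hom_colouring\<close> is injective.\<close>

lemma hom_eq_conj:
  assumes "f \<in> meridian_homs" "a \<in> arcs D"
  shows "f (g a) = inv\<^bsub>G\<^esub> (f (lon a)) \<otimes>\<^bsub>G\<^esub> x \<otimes>\<^bsub>G\<^esub> f (lon a)"
proof -
  interpret f: group_hom \<pi> G f
    using assms by unfold_locales (simp add: meridian_homs_def)
  show ?thesis
    using assms by (simp add: g_eq_conj_meridian meridian_homs_def)
qed

lemma ex_hom_arc_colouring:
  assumes c: "c \<in> arc_colourings"
  shows "\<exists>f\<in>meridian_homs. hom_colouring f = c"
proof -
  have cl [simp]: "c a \<in> carrier G" if "a \<in> arcs D" for a
    using c that by (auto simp: arc_colourings_def)
  have c_top: "c (top_arc D) = \<one>\<^bsub>G\<^esub>"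
    using c by (simp add: arc_colourings_def)
  have c_bot: "c (under_bot D i) =
      (if piece_at D i = XPos
       then inv\<^bsub>G\<^esub> x \<otimes>\<^bsub>G\<^esub> c (under_top D i) \<otimes>\<^bsub>G\<^esub> inv\<^bsub>G\<^esub> (c (over_arc D i)) \<otimes>\<^bsub>G\<^esub> x \<otimes>\<^bsub>G\<^esub> c (over_arc D i)
       else x \<otimes>\<^bsub>G\<^esub> c (under_top D i) \<otimes>\<^bsub>G\<^esub> inv\<^bsub>G\<^esub> (c (over_arc D i)) \<otimes>\<^bsub>G\<^esub> inv\<^bsub>G\<^esub> x \<otimes>\<^bsub>G\<^esub> c (over_arc D i))"
    if "i \<in> crossings D" for i
    using c that by (simp add: arc_colourings_def Let_def)
  \<comment> \<open>The only possible values on the generators, by \<open>hom_eq_conj\<close>. In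
    these terms \<open>c_bot\<close> multiplies the incoming label by inv k(Z) k(X) or k(Z) inv
    k(X), as for longitudes; this yields the Wirtinger relations as in
    \<open>g_eq_conj_meridian\<close>.\<close>
  define k where "k a = inv\<^bsub>G\<^esub> (c a) \<otimes>\<^bsub>G\<^esub> x \<otimes>\<^bsub>G\<^esub> c a" for a
  have "word_value G k u = word_value G k v" if uv: "(u, v) \<in> wirtinger_relations D" for u v
  proof -
    obtain i where i: "i \<in> crossings D" and "(u, v) =
        (if piece_at D i = XPos
         then ([(under_top D i, True), (over_arc D i, True)], [(over_arc D i, True), (under_bot D i, True)])
         else ([(over_arc D i, True), (under_top D i, True)], [(under_bot D i, True), (over_arc D i, True)]))"
      using uv by (auto simp: wirtinger_relations_def Let_def)
    then show ?thesis
      using i by (auto simp: k_def c_bot G.m_assoc G.inv_mult_group split: if_splits)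
  qed
  moreover have "k \<in> arcs D \<rightarrow> carrier G"
    by (auto simp: k_def)
  ultimately obtain f where f: "f \<in> hom \<pi> G \<inter> extensional (carrier \<pi>)" "\<forall>a\<in>arcs D. f (g a) = k a"
    using ex_hom[OF group_G] by blast
  then interpret f: group_hom \<pi> G f
    by unfold_locales simp
  have fg: "f (g a) = k a" if "a \<in> arcs D" for a
    using f(2) that by blast
  have "f (lon a) = c a" if "a \<in> arcs D" for a
    using that
  proof (induction rule: arc_induct)
    case top
    then show ?case by (simp add: arc_longitude_top c_top)
  next
    case (under i)
    then show ?case
      by (simp add: lon_under_bot fg k_def c_bot G.m_assoc G.inv_mult_group)
  qed
  then have "hom_colouring f = c"
    using c by (auto simp: hom_colouring_def fun_eq_iff arc_colourings_def PiE_iff extensional_def)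
  moreover have "f \<in> meridian_homs"
    using f(1) fg[of "top_arc D"] by (simp add: meridian_homs_def meridian_def k_def c_top)
  ultimately show ?thesis by blast
qed

lemma bij_betw_hom_colouring: "bij_betw hom_colouring meridian_homs arc_colourings"
proof (rule bij_betw_imageI)
  show "inj_on hom_colouring meridian_homs"
  proof (rule inj_onI)
    fix f f' assume *: "f \<in> meridian_homs" "f' \<in> meridian_homs" "hom_colouring f = hom_colouring f'"
    have "f (lon a) = f' (lon a)" if "a \<in> arcs D" for a
      using that fun_cong[OF *(3), of a] by (simp add: hom_colouring_def)
    then show "f = f'"
      using * by (intro hom_eq[OF group_G]) (auto simp: hom_eq_conj, auto simp: meridian_homs_def)
  qed
qed (use hom_colouring_in_arc_colourings ex_hom_arc_colouring in blast)

end

lemma coloured_knotI: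
  assumes "braided_crossed_module E G \<delta> br" "finite (carrier G)" "x \<in> carrier G"
    "string_knot_diagram D" "wirtinger_group D \<pi> g"
  shows "coloured_knot E G \<delta> br D \<pi> g x"
proof -
  interpret string_knot D
    by unfold_locales fact
  show ?thesis
    using assms
    by unfold_locales (auto simp: wirtinger_group_def wirtinger_relations_def Let_def split: if_splits)
qed

section \<open>Naturality of the evaluation\<close>

context string_knot
begin

lemma arc_of_top_in_arcs:
  "i < length D \<Longrightarrow> j < length (left_at D i @ piece_top (piece_at D i) @ right_at D i) \<Longrightarrow>
    arc_of D (i, j) \<in> arcs D"
  and arc_of_bot_in_arcs:
  "i < length D \<Longrightarrow> j < length (left_at D i @ piece_bot (piece_at D i) @ right_at D i) \<Longrightarrow>
    arc_of D (Suc i, j) \<in> arcs D"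
  by (auto simp: arcs_def points_def level_top level_bot simp del: level.simps)

end

text \<open>The evaluation is an expression in the labels, so its naturality asks only that the two
  labellings correspond under \<open>f\<close> and \<open>hat\<close>.\<close>

locale evaluation_morphism = braided_hom E G \<delta> br \<pi> f + string_knot D
  for E :: "('e, 'k) monoid_scheme" and G :: "('h, 'n) monoid_scheme"
    and \<delta> :: "'e \<Rightarrow> 'h" and br :: "'h \<Rightarrow> 'h \<Rightarrow> 'e"
    and \<pi> :: "('p, 'q) monoid_scheme" and f D +
  fixes c :: "arc \<Rightarrow> 'p" and t :: "nat \<Rightarrow> ('p \<times> 'p) word set"
    and c' :: "arc \<Rightarrow> 'h" and t' :: "nat \<Rightarrow> 'e"
  assumes c_closed: "a \<in> arcs D \<Longrightarrow> c a \<in> carrier \<pi>"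
    and t_closed: "i \<in> crossings D \<Longrightarrow> t i \<in> carrier T"
    and c': "a \<in> arcs D \<Longrightarrow> c' a = f (c a)"
    and t': "i \<in> crossings D \<Longrightarrow> t' i = hat \<pi> E br f (t i)"
begin

text \<open>The domain on which \<open>mor_map\<close> respects composition and tensor product:
  \<open>f\<close> and \<open>hat\<close> are multiplicative on the carriers only.\<close>

definition mors :: "('p, ('p \<times> 'p) word set) mor set" where
  "mors = carrier \<pi> \<times> carrier T \<times> carrier \<pi>"

fun mor_map :: "('p, ('p \<times> 'p) word set) mor \<Rightarrow> ('h, 'e) mor" where
  "mor_map (U, e, V) = (f U, hat \<pi> E br f e, f V)"

lemma mor_map_comp:
  "F \<in> mors \<Longrightarrow> F' \<in> mors \<Longrightarrow> mor_comp T F F' \<in> mors \<and>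
    mor_map (mor_comp T F F') = mor_comp E (mor_map F) (mor_map F')"
  by (auto simp: mors_def)

lemma mor_map_tensor:
  "F \<in> mors \<Longrightarrow> F' \<in> mors \<Longrightarrow> mor_tensor T \<pi> Tact F F' \<in> mors \<and>
    mor_map (mor_tensor T \<pi> Tact F F') = mor_tensor E G act (mor_map F) (mor_map F')"
  by (auto simp: mors_def hat_act)

lemma mor_map_id:
  "U \<in> carrier \<pi> \<Longrightarrow> mor_id T U \<in> mors \<and> mor_map (mor_id T U) = mor_id E (f U)"
  by (simp add: mors_def mor_id_def)

lemma mor_map_foldr_tensor:
  assumes "set Fs \<subseteq> mors"
  shows "foldr (mor_tensor T \<pi> Tact) Fs (mor_id T \<one>\<^bsub>\<pi>\<^esub>) \<in> mors \<and>
    mor_map (foldr (mor_tensor T \<pi> Tact) Fs (mor_id T \<one>\<^bsub>\<pi>\<^esub>)) =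
    foldr (mor_tensor E G act) (map mor_map Fs) (mor_id E \<one>\<^bsub>G\<^esub>)"
  using assms by (induction Fs) (auto simp: mor_map_tensor mor_map_id simp del: mor_map.simps)

lemma mor_map_foldl_comp:
  assumes "F \<in> mors" "set Fs \<subseteq> mors"
  shows "foldl (mor_comp T) F Fs \<in> mors \<and>
    mor_map (foldl (mor_comp T) F Fs) = foldl (mor_comp E) (mor_map F) (map mor_map Fs)"
  using assms by (induction Fs arbitrary: F) (auto simp: mor_map_comp simp del: mor_map.simps)

lemma point_obj_map:
  assumes "arc_of D q \<in> arcs D"
  shows "point_obj \<pi> D c q d \<in> carrier \<pi> \<and> point_obj G D c' q d = f (point_obj \<pi> D c q d)"
  using assms by (simp add: point_obj_def strand_obj_def c_closed c')

lemma line_mors_map: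
  assumes "\<And>j. j < length ds \<Longrightarrow> arc_of D (i, s + j) \<in> arcs D"
  shows "set (line_mors T \<pi> D (c, t) i s ds) \<subseteq> mors \<and>
    line_mors E G D (c', t') i s ds = map mor_map (line_mors T \<pi> D (c, t) i s ds)"
  using assms point_obj_map by (auto simp: line_mors_def mor_map_id simp del: mor_map.simps)

lemma piece_mors_map:
  assumes i: "i < length D"
  shows "set (piece_mors T \<pi> D (c, t) i) \<subseteq> mors \<and>
    piece_mors E G D (c', t') i = map mor_map (piece_mors T \<pi> D (c, t) i)"
proof (cases "piece_at D i")
  case Lines
  then show ?thesis by (simp add: piece_mors_def)
next
  case (Cap d)
  then show ?thesis
    using arc_of_bot_in_arcs[OF i] by (simp add: piece_mors_def Let_def mors_def point_obj_map)
next
  case (Cup d)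
  then show ?thesis
    using arc_of_top_in_arcs[OF i] by (simp add: piece_mors_def Let_def mors_def point_obj_map)
next
  case XPos
  then have "i \<in> crossings D"
    using i by (simp add: crossings_def)
  then show ?thesis
    using XPos by (simp add: piece_mors_def Let_def mors_def c_closed t_closed c' t')
next
  case XNeg
  then have "i \<in> crossings D"
    using i by (simp add: crossings_def)
  then show ?thesis
    using XNeg by (simp add: piece_mors_def Let_def mors_def c_closed t_closed c' t')
qed

lemma strip_mor_map:
  assumes i: "i < length D"
  shows "strip_mor T \<pi> Tact D (c, t) i \<in> mors \<and>
    strip_mor E G act D (c', t') i = mor_map (strip_mor T \<pi> Tact D (c, t) i)"
  unfolding strip_mor_def
  using line_mors_map[of "left_at D i" i 0] piece_mors_map[OF i]
    line_mors_map[of "right_at D i" i "length (left_at D i) + length (piece_top (piece_at D i))"]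
    arc_of_top_in_arcs[OF i]
  by (simp add: mor_map_foldr_tensor del: foldr_append)

lemma evaluation_map:
  "mor_elem (evaluation E G act D (c', t')) =
    hat \<pi> E br f (mor_elem (evaluation T \<pi> Tact D (c, t)))"
proof -
  let ?Fs = "map (strip_mor T \<pi> Tact D (c, t)) [0..<length D]"
  have strips: "map (strip_mor E G act D (c', t')) [0..<length D] = map mor_map ?Fs"
    by (simp add: strip_mor_map)
  have "evaluation E G act D (c', t') = mor_map (evaluation T \<pi> Tact D (c, t))"
    unfolding evaluation_def strips
    using mor_map_foldl_comp[of "mor_id T (c (top_arc D))" ?Fs]
    by (auto simp: strip_mor_map mor_map_id c_closed c' image_subset_iff simp del: mor_map.simps)
  then show ?thesis
    by (cases "evaluation T \<pi> Tact D (c, t)") (simp add: mor_elem_def)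
qed

end

lemma (in coloured_knot) evaluation_hom_colouring:
  assumes f: "f \<in> meridian_homs"
  shows "mor_elem (evaluation E G act D (hom_colouring f, crossing_colours (hom_colouring f))) =
    hat \<pi> E br f (longitude_lift D \<pi> g)"
proof -
  interpret f: group_hom \<pi> G f
    using f by unfold_locales (simp add: meridian_homs_def)
  interpret braided_hom E G \<delta> br \<pi> f ..
  have fm: "f m = x"
    using f by (simp add: meridian_homs_def)
  obtain c t where ct: "longitude_colouring D \<pi> g = (c, t)"
    by (cases "longitude_colouring D \<pi> g")
  interpret evaluation_morphism E G \<delta> br \<pi> f D c t "hom_colouring f" "crossing_colours (hom_colouring f)"
  proof
    fix a assume "a \<in> arcs D"
    then show "c a \<in> carrier \<pi>" "hom_colouring f a = f (c a)"
      using ct by (auto simp: longitude_colouring_def hom_colouring_def)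
  next
    fix i assume i: "i \<in> crossings D"
    then have t: "t i = (if piece_at D i = XPos
        then psi_pair T \<pi> (tensor_braiding \<pi>) m (lon (over_arc D i)) (lon (under_bot D i))
        else phi_pair \<pi> (tensor_braiding \<pi>) m (lon (over_arc D i)) (lon (under_bot D i)))"
      using ct by (auto simp: longitude_colouring_def Let_def)
    show "t i \<in> carrier T"
      "crossing_colours (hom_colouring f) i = hat \<pi> E br f (t i)"
      \<comment> \<open>Both pairs are built from group operations and one bracket, which
        \<open>f\<close> and \<open>hat\<close> preserve, and \<open>fm\<close> turns the parameter
        \<open>m\<close> into \<open>x\<close>.\<close>
      using i by (simp_all add: t psi_pair_def phi_pair_def crossing_colours_def hom_colouring_def
          hat_tensor_braiding fm)
  qed
  show ?thesis
    unfolding longitude_lift_def ct by (rule evaluation_map)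
qed

theorem theorem4p36:
  fixes E :: "('e, 'k) monoid_scheme" and G :: "('h, 'n) monoid_scheme"
    and \<delta> :: "'e \<Rightarrow> 'h" and br :: "'h \<Rightarrow> 'h \<Rightarrow> 'e" and x :: 'h
    and D :: diagram and \<pi> :: "('p, 'q) monoid_scheme" and g :: "arc \<Rightarrow> 'p"
  assumes "braided_crossed_module E G \<delta> br"
    and "finite (carrier G)"
    and "x \<in> carrier G"
    and "string_knot_diagram D"
    and "wirtinger_group D \<pi> g"
  shows "(\<Sum>a\<in>carrier G.
            state_sum E G \<delta> (braided_act E G \<delta> br) (psi_pair E G br x) (phi_pair G br x) D \<one>\<^bsub>G\<^esub> a) =
         (\<Sum>f | f \<in> hom \<pi> G \<inter> extensional (carrier \<pi>) \<and> f (meridian D g) = x.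
            frag_of (hat \<pi> E br f (longitude_lift D \<pi> g)))"
proof -
  interpret coloured_knot E G \<delta> br D \<pi> g x
    using assms by (rule coloured_knotI)
  have "(\<Sum>c\<in>arc_colourings. frag_of (mor_elem (evaluation E G act D (c, crossing_colours c)))) =
      (\<Sum>f\<in>meridian_homs. frag_of (hat \<pi> E br f (longitude_lift D \<pi> g)))"
    by (subst sum.reindex_bij_betw[OF bij_betw_hom_colouring, symmetric])
      (simp add: evaluation_hom_colouring)
  then show ?thesis
    by (simp add: sum_state_sum meridian_homs_def)
qed

end
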